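(* Let $n\ge1$ be an integer. There exist self-similar measures $\mu$ on $[0,1]^n$ which have GCP(n) and satisfy $\dim_{\mathrm{H}}\mu<n$.
   Context: A self-similar measure (without rotations) on $\mathbb{R}^n$ is the unique Borel probability measure $\mu$ with $\mu=\sum_{i=1}^lp_i(f_i)_*\mu$, where $l\ge2$, $f_i(x)=r_ix+t_i$, $r_i\in(0,1)$, $t_i\in\mathbb{R}^n$, $(p_i)$ a positive probability vector. $\dim_{\mathrm{H}}\mu$ is the $\mu$-a.e. value of $\lim_{\delta\to0}\log\mu(B(x,\delta))/\log\delta$. $\|x\|$ is the distance from $x$ to $\mathbb{Z}^n$; $A(\delta,Q,\gamma)=\{x\in\mathbb{R}^n:\|Qx-\gamma\|\le\delta\}$. $\mu$ has GCP(n) if there is $\alpha>1/n$ such that for every $\gamma\in[0,1]^n$ there are constants $C_1,C_2,M>0$ with $C_2^{-1}Q\delta^n\le\sum_{q=Q}^{2Q}\mu(A(\delta,q,\gamma))\le C_2Q\delta^n$ for all integers $Q\ge M$ and all $\delta$ with $C_1Q^{-\alpha}\le\delta<1$. *)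

theory Defs
  imports "HOL-Analysis.Analysis" "HOL-Probability.Probability"
begin

text \<open>
  The similarities \<open>f\<^sub>i x = r\<^sub>i x + t\<^sub>i\<close> and the weights \<open>p\<^sub>i\<close> are indexed by \<open>i < l\<close>; values of
  \<open>r\<close>, \<open>t\<close>, \<open>p\<close> beyond \<open>l\<close> play no role. By contractivity there is exactly one Borel probability
  measure satisfying the stationarity equation, so a self-similar measure is introduced as a
  solution of that equation.
\<close>

definition stationary_measure ::
  "nat \<Rightarrow> (nat \<Rightarrow> real) \<Rightarrow> (nat \<Rightarrow> real ^ 'n) \<Rightarrow> (nat \<Rightarrow> real) \<Rightarrow> (real ^ 'n) measure \<Rightarrow> bool" where
  "stationary_measure l r t p \<mu> \<longleftrightarrow>
     prob_space \<mu> \<and> sets \<mu> = sets borel \<and>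
     (\<forall>B \<in> sets borel.
        measure \<mu> B = (\<Sum>i<l. p i * measure (distr \<mu> borel (\<lambda>x. r i *\<^sub>R x + t i)) B))"

definition self_similar_measure :: "(real ^ 'n) measure \<Rightarrow> bool" where
  "self_similar_measure \<mu> \<longleftrightarrow>
     (\<exists>l r t p. 2 \<le> l \<and> (\<forall>i<l. 0 < r i \<and> r i < 1) \<and>
        (\<forall>i<l. 0 < p i) \<and> (\<Sum>i<l. p i) = 1 \<and> stationary_measure l r t p \<mu>)"

text \<open>
  Closed and open balls give the same limit. The junk value \<open>ln 0 = 0\<close> is harmless, since almost
  every point lies in the support, where all balls have positive measure.
\<close>

definition has_dim_H :: "(real ^ 'n) measure \<Rightarrow> real \<Rightarrow> bool" where
  "has_dim_H \<mu> d \<longleftrightarrow>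
     (AE x in \<mu>. ((\<lambda>\<delta>. ln (measure \<mu> (cball x \<delta>)) / ln \<delta>) \<longlongrightarrow> d) (at_right 0))"

definition exact_dimensional :: "(real ^ 'n) measure \<Rightarrow> bool" where
  "exact_dimensional \<mu> \<longleftrightarrow> (\<exists>d. has_dim_H \<mu> d)"

text \<open>Meaningful only for exact dimensional probability measures.\<close>

definition dim_H :: "(real ^ 'n) measure \<Rightarrow> real" where
  "dim_H \<mu> = (THE d. has_dim_H \<mu> d)"

definition int_lattice :: "(real ^ 'n) set" where
  "int_lattice = {z. \<forall>i. z $ i \<in> \<int>}"

text \<open>Distance to the lattice is taken in the Euclidean norm.\<close>

definition approx_set :: "real \<Rightarrow> nat \<Rightarrow> real ^ 'n \<Rightarrow> (real ^ 'n) set" where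
  "approx_set \<delta> q \<gamma> = {x. infdist (real q *\<^sub>R x - \<gamma>) int_lattice \<le> \<delta>}"

definition GCP :: "(real ^ 'n) measure \<Rightarrow> bool" where
  "GCP \<mu> \<longleftrightarrow>
     (\<exists>\<alpha> > 1 / real CARD('n). \<forall>\<gamma> \<in> cbox 0 (1 :: real ^ 'n).
        \<exists>C1 > 0. \<exists>C2 > 0. \<exists>M > 0. \<forall>Q :: nat. \<forall>\<delta> :: real.
          M \<le> real Q \<longrightarrow> C1 * real Q powr (- \<alpha>) \<le> \<delta> \<longrightarrow> \<delta> < 1 \<longrightarrow>
            inverse C2 * real Q * \<delta> ^ CARD('n) \<le> (\<Sum>q = Q..2 * Q. measure \<mu> (approx_set \<delta> q \<gamma>)) \<and>
            (\<Sum>q = Q..2 * Q. measure \<mu> (approx_set \<delta> q \<gamma>)) \<le> C2 * real Q * \<delta> ^ CARD('n))"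

end

(* The measure is a product over the coordinates of digit measures in base B = 2^160, one of which
   omits the upper half of the digits while the others are uniform (hence Lebesgue). It is Ahlfors regular of
   dimension n - 1/160. The Fourier transform of a digit measure at \<xi> is the product over j \<ge> 1 of a normalised
   geometric sum at \<xi>/B^j. Summing one such factor over a full system of residues costs only O(log B),
   which for large B is at most B^(1/16), so the Fourier coefficients up to X have absolute sum
   O(X^(1/16)). The coefficients entering the counting problem sit at the products qh with
   Q \<le> q \<le> 2Q and h = O(1/\<delta>); by the divisor bound d(n) = O(n^(1/3)) they sum to
   O((Q/\<delta>)^(1/3 + 1/16)), which is o(Q) as long as 1/\<delta> \<le> Q^(5/4). Trigonometric majorants and
   minorants of the indicator of a \<delta>-neighbourhood of the integers then give both bounds. In the
   uniform coordinates all nonzero integer Fourier coefficients vanish, so these coordinates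
   contribute a factor of order \<delta> for every single q. *)

theory Submission imports Defs begin

section \<open>Digit measures\<close>

text \<open>Only sums of absolute values of coefficients are controlled, and these suffice because
  GCP averages over q. Taking absolute values also removes gamma, which enters as a phase, so all
  constants are uniform in gamma. For n = 1 the exponent in GCP must exceed 1, so frequencies h up
  to about Q^(5/4) and products q h up to about Q^(9/4) occur. The error is still a power below Q
  because (9/4) (1/3 + 1/16) = 57/64 < 1; this is what the divisor exponent and the loss per digit
  have to satisfy. The same 5/4 serves every n. Just one coordinate is thin: with several, the
  product over the coordinates would contain products of error terms at the same q, and averages
  over q of the separate errors would not control these.\<close>

lemma measure_distr_pmf_of_set:
  fixes N :: "'b measure"
  assumes T: "finite T" "T \<noteq> {}" and "prob_space N"
    and f: "f \<in> measurable (measure_pmf (pmf_of_set T) \<Otimes>\<^sub>M N) K" and A: "A \<in> sets K"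
  shows "measure (distr (measure_pmf (pmf_of_set T) \<Otimes>\<^sub>M N) K f) A =
    (\<Sum>d\<in>T. measure N {x \<in> space N. f (d, x) \<in> A}) / card T"
proof -
  interpret N: prob_space N by fact
  interpret P: pair_prob_space "measure_pmf (pmf_of_set T)" N ..
  let ?A = "f -` A \<inter> space (measure_pmf (pmf_of_set T) \<Otimes>\<^sub>M N)"
  have A': "?A \<in> sets (measure_pmf (pmf_of_set T) \<Otimes>\<^sub>M N)"
    using f A by (rule measurable_sets)
  have sec: "Pair d -` ?A = {x \<in> space N. f (d, x) \<in> A}" for d
    by (auto simp: space_pair_measure)
  have "emeasure (distr (measure_pmf (pmf_of_set T) \<Otimes>\<^sub>M N) K f) A =
      (\<integral>\<^sup>+ d. emeasure N {x \<in> space N. f (d, x) \<in> A} \<partial>measure_pmf (pmf_of_set T))"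
    by (subst emeasure_distr[OF f A], subst N.emeasure_pair_measure_alt[OF A'], simp only: sec)
  also have "\<dots> = (\<integral>\<^sup>+ d. ennreal (measure N {x \<in> space N. f (d, x) \<in> A}) \<partial>measure_pmf (pmf_of_set T))"
    by (simp add: N.emeasure_eq_measure)
  also have "\<dots> = ennreal (\<integral> d. measure N {x \<in> space N. f (d, x) \<in> A} \<partial>measure_pmf (pmf_of_set T))"
    by (intro nn_integral_eq_integral measure_pmf.integrable_const_bound[where B = 1]) auto
  also have "(\<integral> d. measure N {x \<in> space N. f (d, x) \<in> A} \<partial>measure_pmf (pmf_of_set T)) =
      (\<Sum>d\<in>T. measure N {x \<in> space N. f (d, x) \<in> A}) / card T"
    using T by (subst integral_pmf_of_set) auto
  finally show ?thesis
    by (simp add: measure_def sum_nonneg)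
qed

text \<open>The measure is the law of a random series in powers of 1 / B with independent uniform
  digits below L. Prepending a digit acts on the series as the affine map in the claim, and
  prepending an independent digit preserves the law of the sequence
  (\<open>PiM_iter\<close>).\<close>

lemma digit_measure_exists:
  fixes B L :: nat
  assumes B: "2 \<le> B" and L: "0 < L" "L \<le> B"
  shows "\<exists>\<nu> :: real measure. prob_space \<nu> \<and> sets \<nu> = sets borel \<and> measure \<nu> {0..1} = 1 \<and>
    \<nu> = distr (measure_pmf (pmf_of_set {..<L}) \<Otimes>\<^sub>M \<nu>) borel (\<lambda>(d, x). (x + real d) / real B)"
proof -
  define M where "M = measure_pmf (pmf_of_set {..<L})"
  interpret M: prob_space M unfolding M_def by (rule measure_pmf.prob_space_axioms)
  have [measurable_cong]: "sets M = sets (count_space UNIV)" by (simp add: M_def)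
  interpret sequence_space M ..
  \<comment> \<open>Truncating the digits at \<open>B - 1\<close> makes the series converge everywhere, not just almost surely.\<close>
  define X :: "(nat \<Rightarrow> nat) \<Rightarrow> real" where
    "X = (\<lambda>\<omega>. \<Sum>j. real (min (\<omega> j) (B - 1)) / real B ^ Suc j)"
  have [measurable]: "X \<in> borel_measurable S"
    unfolding X_def M_def by measurable
  have geo: "(\<lambda>j. (real B - 1) / real B ^ Suc j) sums 1"
  proof -
    have "(\<lambda>j. (real B - 1) / real B * (1 / real B) ^ j) sums ((real B - 1) / real B * (1 / (1 - 1 / real B)))"
      using B by (intro sums_mult geometric_sums) auto
    moreover have "(real B - 1) / real B * (1 / (1 - 1 / real B)) = 1"
      using B by (simp add: field_simps)
    moreover have "(real B - 1) / real B * (1 / real B) ^ j = (real B - 1) / real B ^ Suc j" for j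
      by (simp add: power_divide)
    ultimately show ?thesis by (simp only:)
  qed
  have le_geo: "real (min (\<omega> j) (B - 1)) / real B ^ Suc j \<le> (real B - 1) / real B ^ Suc j" for \<omega> :: "nat \<Rightarrow> nat" and j
    using B by (intro divide_right_mono) auto
  have summ: "summable (\<lambda>j. real (min (\<omega> j) (B - 1)) / real B ^ Suc j)" for \<omega> :: "nat \<Rightarrow> nat"
    by (rule summable_comparison_test'[OF sums_summable[OF geo], of 0]) (use le_geo in auto)
  have X0: "0 \<le> X \<omega>" for \<omega> unfolding X_def by (intro suminf_nonneg summ) auto
  have X1: "X \<omega> \<le> 1" for \<omega>
    unfolding X_def using suminf_le[OF le_geo summ sums_summable[OF geo]] sums_unique[OF geo] by simp
  have Xs: "X (case_nat d \<omega>) = (X \<omega> + real d) / real B" if "d < L" for d \<omega>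
  proof -
    have "X (case_nat d \<omega>) = (\<Sum>j. real (min (\<omega> j) (B - 1)) / real B ^ Suc j / real B) + real d / real B"
      unfolding X_def using suminf_split_head[OF summ, of "case_nat d \<omega>"] that L by (simp add: mult_ac)
    also have "(\<Sum>j. real (min (\<omega> j) (B - 1)) / real B ^ Suc j / real B) = X \<omega> / real B"
      unfolding X_def by (rule suminf_divide[OF summ])
    finally show ?thesis by (simp add: add_divide_distrib)
  qed
  define \<nu> where "\<nu> = distr S borel X"
  have [measurable_cong]: "sets \<nu> = sets borel" by (simp add: \<nu>_def)
  have f [measurable]: "(\<lambda>(d, x). (x + real d) / real B) \<in> borel_measurable (M \<Otimes>\<^sub>M borel)"
    unfolding M_def by measurable
  have "distr (M \<Otimes>\<^sub>M \<nu>) borel (\<lambda>(d, x). (x + real d) / real B) =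
      distr (distr M M (\<lambda>x. x) \<Otimes>\<^sub>M \<nu>) borel (\<lambda>(d, x). (x + real d) / real B)"
    by (simp add: distr_id2)
  also have "\<dots> = distr (distr (M \<Otimes>\<^sub>M S) (M \<Otimes>\<^sub>M borel) (\<lambda>(d, \<omega>). (d, X \<omega>))) borel (\<lambda>(d, x). (x + real d) / real B)"
    unfolding \<nu>_def by (subst pair_measure_distr) (auto intro!: prob_space_imp_sigma_finite P.prob_space_distr)
  also have "\<dots> = distr (M \<Otimes>\<^sub>M S) borel (\<lambda>(d, \<omega>). (X \<omega> + real d) / real B)"
    by (subst distr_distr) (simp_all add: comp_def case_prod_beta')
  also have "\<dots> = distr (M \<Otimes>\<^sub>M S) borel (\<lambda>(d, \<omega>). X (case_nat d \<omega>))"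
  \<comment> \<open>The truncation makes \<open>Xs\<close> available only for d < L, so the two maps
    agree merely almost surely.\<close>
  proof (rule distr_cong_AE)
    have "AE x in distr (M \<Otimes>\<^sub>M S) M fst. x < L"
    proof (subst distr_pair_fst)
      show "AE x in M. x < L"
        using L unfolding M_def AE_measure_pmf_iff by (subst set_pmf_of_set) (auto simp: lessThan_empty_iff)
    qed
    hence "AE x in M \<Otimes>\<^sub>M S. fst x < L"
      by (subst (asm) AE_distr_iff) (auto simp: M_def)
    thus "AE x in M \<Otimes>\<^sub>M S. (case x of (d, \<omega>) \<Rightarrow> (X \<omega> + real d) / real B) = (case x of (d, \<omega>) \<Rightarrow> X (case_nat d \<omega>))"
      by eventually_elim (auto simp: Xs)
  qed measurable
  also have "\<dots> = distr (distr (M \<Otimes>\<^sub>M S) S (\<lambda>(d, \<omega>). case_nat d \<omega>)) borel X"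
    by (subst distr_distr) (simp_all add: comp_def case_prod_beta')
  also have "\<dots> = \<nu>" by (simp add: PiM_iter \<nu>_def)
  finally have "\<nu> = distr (M \<Otimes>\<^sub>M \<nu>) borel (\<lambda>(d, x). (x + real d) / real B)" ..
  moreover have "measure \<nu> {0..1} = 1"
  proof -
    have "X -` {0..1} \<inter> space S = space S" using X0 X1 by auto
    thus ?thesis unfolding \<nu>_def by (simp add: measure_distr P.prob_space)
  qed
  ultimately show ?thesis
    unfolding M_def[symmetric] by (intro exI[of _ \<nu>]) (auto simp: \<nu>_def intro: prob_space_distr)
qed

section \<open>Fourier transform of digit measures\<close>

text \<open>Stationarity is kept as an identity of laws with a random digit; the finite averages for
  sets (\<open>prob_step\<close>) and for integrals (\<open>integral_step\<close>) both follow from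
  it by Fubini.\<close>

locale digit_measure = prob_space \<nu> for \<nu> :: "real measure" +
  fixes B L :: nat
  assumes B: "2 \<le> B" and L: "0 < L" "L \<le> B"
    and sets_eq [measurable_cong]: "sets \<nu> = sets borel"
    and supp: "prob {0..1} = 1"
    and self_similar: "\<nu> = distr (measure_pmf (pmf_of_set {..<L}) \<Otimes>\<^sub>M \<nu>) borel (\<lambda>(d, x). (x + real d) / real B)"
begin

lemma space_eq [simp]: "space \<nu> = UNIV"
  using sets_eq_imp_space_eq[OF sets_eq] by simp

lemma map_measurable [measurable]:
  "(\<lambda>(d, x). (x + real d) / real B) \<in> borel_measurable (measure_pmf (pmf_of_set {..<L}) \<Otimes>\<^sub>M \<nu>)"
  by measurable

lemma prob_step:
  assumes "A \<in> sets borel"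
  shows "prob A = (\<Sum>d<L. prob {x. (x + real d) / real B \<in> A}) / real L"
proof -
  have "prob A = measure (distr (measure_pmf (pmf_of_set {..<L}) \<Otimes>\<^sub>M \<nu>) borel (\<lambda>(d, x). (x + real d) / real B)) A"
    using self_similar by simp
  also have "\<dots> = (\<Sum>d<L. prob {x. (x + real d) / real B \<in> A}) / real L"
    using L assms by (subst measure_distr_pmf_of_set) (auto intro: prob_space_axioms simp: lessThan_empty_iff)
  finally show ?thesis .
qed

lemma integral_step:
  fixes f :: "real \<Rightarrow> complex"
  assumes [measurable]: "f \<in> borel_measurable borel" and bd: "\<And>x. norm (f x) \<le> C"
  shows "(\<integral>x. f x \<partial>\<nu>) = (\<Sum>d<L. \<integral>x. f ((x + real d) / real B) \<partial>\<nu>) / of_nat L"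
proof -
  interpret P: pair_prob_space "measure_pmf (pmf_of_set {..<L})" \<nu> ..
  have "(\<integral>x. f x \<partial>\<nu>) = (\<integral>x. f x \<partial>distr (measure_pmf (pmf_of_set {..<L}) \<Otimes>\<^sub>M \<nu>) borel (\<lambda>(d, x). (x + real d) / real B))"
    using self_similar by simp
  also have "\<dots> = (\<integral>z. f ((snd z + real (fst z)) / real B) \<partial>(measure_pmf (pmf_of_set {..<L}) \<Otimes>\<^sub>M \<nu>))"
    by (subst integral_distr) (auto simp: case_prod_beta)
  also have "\<dots> = (\<integral>d. \<integral>x. f ((x + real d) / real B) \<partial>\<nu> \<partial>measure_pmf (pmf_of_set {..<L}))"
    by (subst P.integral_fst'[symmetric])
       (auto intro!: P.integrable_const_bound[where B = C] bd)
  also have "\<dots> = (\<Sum>d<L. \<integral>x. f ((x + real d) / real B) \<partial>\<nu>) / of_nat L"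
    using L by (subst integral_measure_pmf[of "{..<L}"])
       (auto simp: lessThan_empty_iff scaleR_conv_of_real divide_inverse sum_distrib_left mult.commute)
  finally show ?thesis .
qed

end

text \<open>The Fourier transform of the uniform distribution on the digits below L: up to a phase,
  the normalised Dirichlet kernel.\<close>

definition digit_char :: "nat \<Rightarrow> real \<Rightarrow> complex" where
  "digit_char L \<theta> = (\<Sum>d<L. cis (2 * pi * \<theta> * real d)) / of_nat L"

definition fourier :: "real measure \<Rightarrow> real \<Rightarrow> complex" where
  "fourier \<nu> \<xi> = (\<integral>x. cis (2 * pi * \<xi> * x) \<partial>\<nu>)"

lemma cis_int [simp]: "cis (2 * pi * of_int n) = 1" "cis (2 * pi * of_nat m) = 1"
  by (simp_all add: complex_eq_iff)

lemma norm_digit_char_le: "norm (digit_char L \<theta>) \<le> 1"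
proof -
  have "norm (\<Sum>d<L. cis (2 * pi * \<theta> * real d)) \<le> (\<Sum>d<L. 1)"
    by (rule order_trans[OF norm_sum]) simp
  thus ?thesis by (cases "L = 0") (auto simp: digit_char_def norm_divide)
qed

lemma digit_char_add_nat: "digit_char L (\<theta> + of_nat n) = digit_char L \<theta>"
proof -
  have "cis (2 * pi * (\<theta> + real n) * real d) = cis (2 * pi * \<theta> * real d)" for d
  proof -
    have "cis (2 * pi * (\<theta> + real n) * real d) = cis (2 * pi * \<theta> * real d) * cis (2 * pi * of_nat (n * d))"
      by (simp add: cis_mult algebra_simps)
    thus ?thesis by (simp only: cis_int) simp
  qed
  thus ?thesis by (simp add: digit_char_def)
qed

lemma digit_char_geometric:
  "of_nat L * digit_char L \<theta> * (1 - cis (2 * pi * \<theta>)) = 1 - cis (2 * pi * \<theta> * real L)"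
proof (cases "L = 0")
  case False
  have pow: "cis (2 * pi * \<theta> * real d) = cis (2 * pi * \<theta>) ^ d" for d
    by (subst Complex.DeMoivre) (rule arg_cong[where f = cis], rule mult.commute)
  have "of_nat L * digit_char L \<theta> = (\<Sum>d<L. cis (2 * pi * \<theta>) ^ d)"
    using False by (simp add: digit_char_def pow)
  also have "\<dots> * (1 - cis (2 * pi * \<theta>)) = 1 - cis (2 * pi * \<theta>) ^ L"
    unfolding one_diff_power_eq by (rule mult.commute)
  finally show ?thesis by (simp only: pow)
qed simp

lemma norm_one_minus_cis: "norm (1 - cis t) = 2 * \<bar>sin (t / 2)\<bar>"
proof -
  have "(norm (1 - cis t))\<^sup>2 = (1 - cos t)\<^sup>2 + (sin t)\<^sup>2"
    by (simp add: cmod_power2)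
  also have "\<dots> = 2 - 2 * cos t"
    using sin_cos_squared_add[of t] by (simp add: power2_eq_square algebra_simps)
  also have "\<dots> = (2 * \<bar>sin (t / 2)\<bar>)\<^sup>2"
    using cos_double_sin[of "t / 2"] by (simp add: power_mult_distrib)
  finally show ?thesis by (rule power2_eq_imp_eq) auto
qed

text \<open>Half of the sharp bound 2 t is enough. Up to t = 1/3 the cosine is at least 1/2, so sin
  y is at least y / 2, and pi is at least 2; beyond that, sin is already at least 1/2.\<close>

lemma sin_pi_ge:
  assumes "0 \<le> t" "t \<le> 1 / 2"
  shows "t \<le> sin (pi * t)"
proof (cases "t \<le> 1 / 3")
  case True
  have "(\<lambda>y. sin y - y / 2) 0 \<le> (\<lambda>y. sin y - y / 2) (pi * t)"
  proof (rule DERIV_nonneg_imp_nondecreasing[where f = "\<lambda>y. sin y - y / 2"])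
    show "0 \<le> pi * t" using assms by simp
    fix y assume y: "0 \<le> y" "y \<le> pi * t"
    have "pi * t \<le> pi * (1 / 3)" using True pi_gt_zero by (intro mult_left_mono) auto
    hence "y \<le> pi / 3" using y by linarith
    hence "cos (pi / 3) \<le> cos y" using y by (intro cos_monotone_0_pi_le) auto
    hence "0 \<le> cos y - 1 / 2" by (simp add: cos_60)
    moreover have "((\<lambda>y. sin y - y / 2) has_real_derivative (cos y - 1 / 2)) (at y)"
      by (auto intro!: derivative_eq_intros)
    ultimately show "\<exists>d. ((\<lambda>y. sin y - y / 2) has_real_derivative d) (at y) \<and> 0 \<le> d" by blast
  qed
  moreover have "2 * t \<le> pi * t" using assms pi_ge_two by (intro mult_right_mono) auto
  ultimately show ?thesis by simp
next
  case False
  have "sin (pi / 6) \<le> sin (pi * t)"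
    using False assms pi_gt_zero by (intro sin_monotone_2pi_le) (auto simp: field_simps)
  thus ?thesis using assms by (simp add: sin_30)
qed

lemma norm_one_minus_cis_ge:
  assumes "\<bar>t\<bar> \<le> 1 / 2"
  shows "2 * \<bar>t\<bar> \<le> norm (1 - cis (2 * pi * t))"
proof -
  have "\<bar>t\<bar> \<le> sin (pi * \<bar>t\<bar>)" using assms by (intro sin_pi_ge) auto
  also have "\<dots> \<le> \<bar>sin (pi * t)\<bar>" by (cases "0 \<le> t") auto
  finally show ?thesis by (simp add: norm_one_minus_cis)
qed

text \<open>The closed form of the geometric sum is bounded through the distance m from t to the
  nearest integer. The reciprocal of m is replaced by a sum of two reciprocals, since these turn
  into two harmonic sums when t runs through residues.\<close>

lemma norm_digit_char_le_inverse:
  assumes "0 < t" "t < 1"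
  shows "norm (digit_char L t) \<le> (1 / t + 1 / (1 - t)) / real L"
proof (cases "L = 0")
  case False
  define m where "m = min t (1 - t)"
  have m: "0 < m" using assms by (simp add: m_def)
  have "2 * m \<le> norm (1 - cis (2 * pi * t))"
  proof (cases "t \<le> 1 / 2")
    case True
    thus ?thesis using norm_one_minus_cis_ge[of t] assms by (simp add: m_def)
  next
    case F: False
    have "cis (2 * pi * (t - 1)) = cis (2 * pi * t) * cis (2 * pi * of_int (- 1))"
      unfolding cis_mult by (simp add: algebra_simps)
    hence "cis (2 * pi * (t - 1)) = cis (2 * pi * t)" by (simp only: cis_int mult_1_right)
    thus ?thesis using norm_one_minus_cis_ge[of "t - 1"] assms F by (simp add: m_def)
  qed
  moreover have "norm (1 - cis (2 * pi * t * real L)) \<le> 2"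
    using norm_triangle_ineq4[of 1 "cis (2 * pi * t * real L)"] by simp
  moreover have "real L * norm (digit_char L t) * norm (1 - cis (2 * pi * t)) = norm (1 - cis (2 * pi * t * real L))"
    unfolding digit_char_geometric[symmetric] by (simp add: norm_mult)
  ultimately have "real L * norm (digit_char L t) * (2 * m) \<le> 2"
    by (smt (verit) mult_left_mono mult_nonneg_nonneg norm_ge_zero of_nat_0_le_iff)
  hence "norm (digit_char L t) \<le> 1 / m / real L"
    using m False by (simp add: field_simps)
  also have "1 / m \<le> 1 / t + 1 / (1 - t)"
    using assms by (auto simp: m_def min_def)
  hence "1 / m / real L \<le> (1 / t + 1 / (1 - t)) / real L"
    by (intro divide_right_mono) auto
  finally show ?thesis .
qed (simp add: digit_char_def)

text \<open>The sample points are 1 / B apart. The outer two may be arbitrarily close to an integer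
  and get the trivial bound 1 each, which is the 2. The others are at distance at least d / B from 0
  and (B - 1 - d) / B from 1, and each side contributes a harmonic sum.\<close>

lemma sum_digit_char_le:
  assumes B: "2 \<le> B" and L: "0 < L" and th: "0 \<le> \<theta>" "\<theta> < 1 / real B"
  shows "(\<Sum>d<B. norm (digit_char L (\<theta> + real d / real B))) \<le> 2 + 2 * real B / real L * harm B"
proof -
  have "(\<Sum>d<B. norm (digit_char L (\<theta> + real d / real B))) \<le>
     (\<Sum>d<B. (if d = 0 then 1 else 0) + (if d = B - 1 then 1 else 0) +
        real B / real L * ((if d = 0 then 0 else 1 / real d) + (if d = B - 1 then 0 else 1 / real (B - 1 - d))))"
  proof (rule sum_mono)
    fix d assume d: "d \<in> {..<B}"
    show "norm (digit_char L (\<theta> + real d / real B)) \<le> (if d = 0 then 1 else 0) + (if d = B - 1 then 1 else 0) +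
        real B / real L * ((if d = 0 then 0 else 1 / real d) + (if d = B - 1 then 0 else 1 / real (B - 1 - d)))"
    proof (cases "d = 0 \<or> d = B - 1")
      case True
      thus ?thesis
        by (intro order_trans[OF norm_digit_char_le]) auto
    next
      case False
      let ?t = "\<theta> + real d / real B"
      have d': "0 < d" "d < B - 1" "real (B - 1 - d) = real B - 1 - real d" using d False by auto
      have t1: "real d / real B \<le> ?t" using th by simp
      have t2: "real (B - 1 - d) / real B \<le> 1 - ?t"
      proof -
        have "real (B - 1 - d) / real B = 1 - 1 / real B - real d / real B"
          using B d'(3) by (simp add: diff_divide_distrib)
        thus ?thesis using th by linarith
      qed
      have p: "0 < real d / real B" "0 < real (B - 1 - d) / real B" using d' B by auto
      have t01: "0 < ?t" "0 < 1 - ?t"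
        by (rule less_le_trans[OF p(1) t1], rule less_le_trans[OF p(2) t2])
      have "norm (digit_char L ?t) \<le> (1 / ?t + 1 / (1 - ?t)) / real L"
        using t01 by (intro norm_digit_char_le_inverse) simp_all
      also have "\<dots> \<le> (1 / (real d / real B) + 1 / (real (B - 1 - d) / real B)) / real L"
        by (intro divide_right_mono add_mono divide_left_mono mult_pos_pos p t01 t1 t2) simp_all
      also have "\<dots> = real B / real L * (1 / real d + 1 / real (B - 1 - d))"
        by (simp add: distrib_left add_divide_distrib mult.commute)
      finally show ?thesis using False by simp
    qed
  qed
  also have "\<dots> = 2 + real B / real L * ((\<Sum>d<B. if d = 0 then 0 else 1 / real d) +
      (\<Sum>d<B. if d = B - 1 then 0 else 1 / real (B - 1 - d)))"
    unfolding sum.distrib sum_distrib_left[symmetric] using B by simp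
  also have "(\<Sum>d<B. if d = B - 1 then 0 else 1 / real (B - 1 - d)) = (\<Sum>d<B. if d = 0 then 0 else 1 / real d)"
    by (rule sum.reindex_bij_witness[of _ "\<lambda>d. B - 1 - d" "\<lambda>d. B - 1 - d"]) auto
  also have "(\<Sum>d<B. if d = 0 then 0 else 1 / real d) \<le> harm B"
  proof -
    have "(\<Sum>d<B. if d = 0 then 0 else 1 / real d) = (\<Sum>d\<in>{1..<B}. 1 / real d)"
      by (rule sum.mono_neutral_cong_right) auto
    also have "\<dots> \<le> (\<Sum>d\<in>{1..B}. 1 / real d)" by (rule sum_mono2) auto
    finally show ?thesis by (simp add: harm_def inverse_eq_divide)
  qed
  hence "2 + real B / real L * ((\<Sum>d<B. if d = 0 then 0 else 1 / real d) + (\<Sum>d<B. if d = 0 then 0 else 1 / real d))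
     \<le> 2 + real B / real L * (harm B + harm B)"
    by (intro add_left_mono mult_left_mono add_mono) auto
  finally show ?thesis by (simp add: algebra_simps)
qed

text \<open>Each dyadic block has 2^k terms, none larger than 2^(-k), and so contributes at most
  1.\<close>

lemma harm_power_two_le: "harm (2 ^ k) \<le> (real k + 1 :: real)"
proof (induction k)
  case (Suc k)
  have "harm (2 ^ Suc k) = (harm (2 ^ k) :: real) + (\<Sum>i\<in>{2 ^ k<..2 ^ Suc k}. inverse (real i))"
  proof -
    have "{1..2 ^ Suc k} = {1..2 ^ k} \<union> {2 ^ k<..2 ^ Suc k :: nat}" by auto
    thus ?thesis unfolding harm_def by (simp only:) (subst sum.union_disjoint, auto)
  qed
  also have "(\<Sum>i\<in>{2 ^ k<..2 ^ Suc k}. inverse (real i)) \<le> (\<Sum>i\<in>{2 ^ k<..2 ^ Suc k :: nat}. inverse (2 ^ k))"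
  proof (rule sum_mono)
    fix i :: nat assume "i \<in> {2 ^ k<..2 ^ Suc k}"
    hence "real (2 ^ k) \<le> real i" by (subst of_nat_le_iff) auto
    thus "inverse (real i) \<le> inverse (2 ^ k)" by (intro le_imp_inverse_le) auto
  qed
  also have "\<dots> = 1" by simp
  finally show ?case using Suc by simp
qed (simp add: harm_def)

text \<open>
  For \<open>j \<le> m\<close> the factor at \<open>n / B ^ j\<close> only depends on \<open>n mod B ^ m\<close>, so the leading digit of \<open>n\<close>
  can be summed separately.
\<close>

lemma sum_prod_digit_char_le:
  assumes S: "\<And>\<theta>. 0 \<le> \<theta> \<Longrightarrow> \<theta> < 1 / real B \<Longrightarrow> (\<Sum>d<B. norm (digit_char L (\<theta> + real d / real B))) \<le> S"
    and B: "2 \<le> B"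
  shows "(\<Sum>n<B ^ m. \<Prod>j\<in>{1..m}. norm (digit_char L (real n / real B ^ j))) \<le> S ^ m"
proof (induction m)
  case (Suc m)
  have "(\<Sum>d<B. norm (digit_char L (0 + real d / real B))) \<le> S" using B by (intro S) auto
  hence S0: "0 \<le> S" by (rule order_trans[rotated]) (auto intro: sum_nonneg)
  let ?P = "\<lambda>n. \<Prod>j\<in>{1..m}. norm (digit_char L (real n / real B ^ j))"
  have per: "?P (n + d * B ^ m) = ?P n" for n d
  proof (rule prod.cong[OF refl])
    fix j assume j: "j \<in> {1..m}"
    have "real B ^ m = real B ^ (m - j) * real B ^ j" using j by (simp flip: power_add)
    hence "real (n + d * B ^ m) / real B ^ j = real n / real B ^ j + real (d * B ^ (m - j))"
      using B by (simp add: add_divide_distrib)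
    thus "norm (digit_char L (real (n + d * B ^ m) / real B ^ j)) = norm (digit_char L (real n / real B ^ j))"
      by (simp only: digit_char_add_nat)
  qed
  have "(\<Sum>n<B ^ Suc m. \<Prod>j\<in>{1..Suc m}. norm (digit_char L (real n / real B ^ j))) =
     (\<Sum>n<B ^ Suc m. ?P n * norm (digit_char L (real n / real B ^ Suc m)))"
    by simp
  also have "\<dots> = (\<Sum>(d, n)\<in>{..<B} \<times> {..<B ^ m}. ?P (n + d * B ^ m) * norm (digit_char L (real (n + d * B ^ m) / real B ^ Suc m)))"
  proof (rule sum.reindex_bij_witness[of _ "\<lambda>(d, n). n + d * B ^ m" "\<lambda>n. (n div B ^ m, n mod B ^ m)"])
    fix z assume z: "z \<in> {..<B} \<times> {..<B ^ m}"
    obtain d n where [simp]: "z = (d, n)" by force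
    have dn: "d < B" "n < B ^ m" using z by auto
    hence "n + d * B ^ m < (d + 1) * B ^ m" by simp
    also have "\<dots> \<le> B * B ^ m" using dn by (intro mult_right_mono) auto
    finally show "(case z of (d, n) \<Rightarrow> n + d * B ^ m) \<in> {..<B ^ Suc m}" by simp
    show "(\<lambda>n. (n div B ^ m, n mod B ^ m)) (case z of (d, n) \<Rightarrow> n + d * B ^ m) = z"
      using dn B by simp
  next
    fix n assume n: "n \<in> {..<B ^ Suc m}"
    show "(\<lambda>n. (n div B ^ m, n mod B ^ m)) n \<in> {..<B} \<times> {..<B ^ m}"
      using n B by (auto simp: less_mult_imp_div_less)
    have "n mod B ^ m + n div B ^ m * B ^ m = n" by (simp only: mod_div_mult_eq)
    thus "(case (n div B ^ m, n mod B ^ m) of (d, n) \<Rightarrow> n + d * B ^ m) = n"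
      and "(case (n div B ^ m, n mod B ^ m) of (d, n) \<Rightarrow> ?P (n + d * B ^ m) * norm (digit_char L (real (n + d * B ^ m) / real B ^ Suc m)))
        = ?P n * norm (digit_char L (real n / real B ^ Suc m))"
      by (simp_all only: prod.case)
  qed
  also have "\<dots> = (\<Sum>n<B ^ m. ?P n * (\<Sum>d<B. norm (digit_char L (real n / real B ^ Suc m + real d / real B))))"
  proof -
    have "real (n + d * B ^ m) / real B ^ Suc m = real n / real B ^ Suc m + real d / real B" for n d
      using B by (simp add: field_simps)
    thus ?thesis
      by (simp only: per sum.cartesian_product[symmetric] sum_distrib_left) (rule sum.swap)
  qed
  also have "\<dots> \<le> (\<Sum>n<B ^ m. ?P n * S)"
  proof (intro sum_mono mult_left_mono S)
    fix n assume "n \<in> {..<B ^ m}"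
    hence "real n < real B ^ m" by (metis lessThan_iff of_nat_less_iff of_nat_power)
    thus "real n / real B ^ Suc m < 1 / real B" using B by (simp add: field_simps)
  qed (auto intro: prod_nonneg)
  also have "\<dots> \<le> S ^ m * S"
    using Suc S0 by (simp only: sum_distrib_right[symmetric]) (rule mult_right_mono)
  finally show ?case by (simp add: mult.commute)
qed simp

section \<open>Functional equation of the transform and vanishing in the uniform case\<close>

lemma integrable_cis_affine:
  assumes "prob_space \<nu>" "sets \<nu> = sets borel"
  shows "integrable \<nu> (\<lambda>x. cis (a * x + b))"
proof -
  interpret prob_space \<nu> by fact
  have [measurable_cong]: "sets \<nu> = sets borel" by fact
  show ?thesis by (rule integrable_const_bound[where B = 1]) (auto simp: cis_conv_exp)
qed

context digit_measure
begin

lemma fourier_step: "fourier \<nu> \<xi> = digit_char L (\<xi> / real B) * fourier \<nu> (\<xi> / real B)"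
proof -
  have "fourier \<nu> \<xi> = (\<Sum>d<L. \<integral>x. cis (2 * pi * \<xi> * ((x + real d) / real B)) \<partial>\<nu>) / of_nat L"
    unfolding fourier_def by (rule integral_step[where C = 1]) (auto simp: cis_conv_exp)
  also have "(\<Sum>d<L. \<integral>x. cis (2 * pi * \<xi> * ((x + real d) / real B)) \<partial>\<nu>) =
     (\<Sum>d<L. cis (2 * pi * (\<xi> / real B) * real d) * fourier \<nu> (\<xi> / real B))"
    unfolding fourier_def
  proof (rule sum.cong[OF refl])
    fix d
    have "cis (2 * pi * \<xi> * ((x + real d) / real B)) =
       cis (2 * pi * (\<xi> / real B) * real d) * cis (2 * pi * (\<xi> / real B) * x)" for x
      using B by (simp add: cis_mult field_simps)
    thus "(\<integral>x. cis (2 * pi * \<xi> * ((x + real d) / real B)) \<partial>\<nu>) =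
      cis (2 * pi * (\<xi> / real B) * real d) * (\<integral>x. cis (2 * pi * (\<xi> / real B) * x) \<partial>\<nu>)"
      by simp
  qed
  finally show ?thesis by (simp add: digit_char_def sum_distrib_right[symmetric])
qed

lemma norm_fourier_le_1: "norm (fourier \<nu> \<xi>) \<le> 1"
  unfolding fourier_def
  by (rule order_trans[OF integral_norm_bound]) (simp add: prob_space)

lemma norm_fourier_le_prod: "norm (fourier \<nu> \<xi>) \<le> (\<Prod>j\<in>{1..m}. norm (digit_char L (\<xi> / real B ^ j)))"
proof -
  have "norm (fourier \<nu> \<xi>) = (\<Prod>j\<in>{1..m}. norm (digit_char L (\<xi> / real B ^ j))) * norm (fourier \<nu> (\<xi> / real B ^ m))"
  proof (induction m)
    case (Suc m)
    show ?case
      unfolding Suc by (subst fourier_step) (simp add: norm_mult mult_ac)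
  qed simp
  also have "\<dots> \<le> (\<Prod>j\<in>{1..m}. norm (digit_char L (\<xi> / real B ^ j))) * 1"
    by (intro mult_left_mono norm_fourier_le_1 prod_nonneg) auto
  finally show ?thesis by simp
qed

text \<open>Strip factors B from n with \<open>fourier_step\<close> until n is not divisible by B;
  the next digit factor is then the complete sum over the powers of a nontrivial B-th root of
  unity.\<close>

lemma fourier_nat_eq_0:
  assumes "L = B" "0 < n"
  shows "fourier \<nu> (real n) = 0"
  using assms(2)
proof (induction n rule: less_induct)
  case (less n)
  show ?case
  proof (cases "B dvd n")
    case True
    then obtain k where k: "n = B * k" by auto
    have "fourier \<nu> (real k) = 0" using k less.prems B by (intro less.IH) auto
    moreover have "real n / real B = real k" using k B by simp
    ultimately show ?thesis by (subst fourier_step) simp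
  next
    case False
    have "cis (2 * pi * (real n / real B)) \<noteq> 1"
    proof
      assume "cis (2 * pi * (real n / real B)) = 1"
      hence "cos (2 * pi * (real n / real B)) = 1" by (simp add: complex_eq_iff)
      then obtain i :: int where "2 * pi * (real n / real B) = of_int i * 2 * pi"
        by (auto simp: cos_one_2pi_int)
      hence "real n = of_int i * real B" using B by (simp add: field_simps)
      hence "int n = i * int B" by (metis of_int_eq_iff of_int_mult of_int_of_nat_eq)
      thus False using False by (metis dvd_triv_right int_dvd_int_iff)
    qed
    moreover have "cis (2 * pi * (real n / real B) * real L) = 1"
    proof -
      have "2 * pi * (real n / real B) * real L = 2 * pi * of_nat n" using assms B by simp
      thus ?thesis by (simp only: cis_int)
    qed
    ultimately have "digit_char L (real n / real B) = 0"
      using digit_char_geometric[of L "real n / real B"] L by simp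
    thus ?thesis by (subst fourier_step) simp
  qed
qed

end

section \<open>The divisor bound\<close>

text \<open>Only an upper bound is wanted, so it is enough that multiplication maps pairs of
  divisors onto the divisors of the product.\<close>

lemma card_divisors_mult_le:
  fixes m n :: nat
  assumes "0 < m" "0 < n"
  shows "card {d. d dvd m * n} \<le> card {d. d dvd m} * card {d. d dvd n}"
proof -
  have fin: "finite ({d. d dvd m} \<times> {d. d dvd n})" using assms by auto
  have "{d. d dvd m * n} \<subseteq> (\<lambda>(a, b). a * b) ` ({d. d dvd m} \<times> {d. d dvd n})"
  proof
    fix d assume "d \<in> {d. d dvd m * n}"
    then obtain a b where "d = a * b" "a dvd m" "b dvd n" using division_decomp by blast
    thus "d \<in> (\<lambda>(a, b). a * b) ` ({d. d dvd m} \<times> {d. d dvd n})" by force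
  qed
  hence "card {d. d dvd m * n} \<le> card ((\<lambda>(a, b). a * b) ` ({d. d dvd m} \<times> {d. d dvd n}))"
    using fin by (intro card_mono) auto
  also have "\<dots> \<le> card ({d. d dvd m} \<times> {d. d dvd n})" using fin by (rule card_image_le)
  finally show ?thesis by (simp add: card_cartesian_product)
qed

lemma card_divisors_prime_power_le:
  fixes p :: nat
  assumes "prime p"
  shows "card {d. d dvd p ^ k} \<le> k + 1"
proof -
  have "{d. d dvd p ^ k} = (\<lambda>i. p ^ i) ` {..k}"
    using divides_primepow_nat[OF assms] by auto
  thus ?thesis using card_image_le[of "{..k}" "\<lambda>i. p ^ i"] by simp
qed

text \<open>Equality holds at a = 3, and from there on the ratio of consecutive cubes stays below
  2.\<close>

lemma cube_Suc_le: "(a + 1) ^ 3 \<le> 8 * 2 ^ (a :: nat)"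
proof (cases "a \<le> 3")
  case True
  hence "a = 0 \<or> a = 1 \<or> a = 2 \<or> a = 3" by auto
  thus ?thesis by (auto simp: power3_eq_cube)
next
  case False
  hence "3 \<le> a" by simp
  thus ?thesis
  proof (induction a rule: dec_induct)
    case (step a)
    have "(3 * 3) * a \<le> (a * a) * a" using step(1) by (intro mult_right_mono mult_mono) auto
    moreover have "(Suc a + 1) ^ 3 = (a * a) * a + 6 * (a * a) + 12 * a + 8"
      by (simp add: power3_eq_cube algebra_simps)
    moreover have "(a + 1) ^ 3 = (a * a) * a + 3 * (a * a) + 3 * a + 1"
      by (simp add: power3_eq_cube algebra_simps)
    ultimately have "(Suc a + 1) ^ 3 \<le> 2 * (a + 1) ^ 3" using step(1) by linarith
    thus ?case using step.IH by simp
  qed auto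
qed

text \<open>
  A prime \<open>p \<ge> 8\<close> at most doubles the number of divisors, which \<open>p\<close> pays for after cubing; each of
  the finitely many smaller primes costs a factor \<open>8\<close> through \<open>cube_Suc_le\<close>.
\<close>

lemma card_divisors_cube_le_aux:
  fixes S :: "nat set"
  assumes "finite S" "\<And>p. p \<in> S \<Longrightarrow> prime p" "0 < n" "\<And>p. prime p \<Longrightarrow> p dvd n \<Longrightarrow> p < 8 \<Longrightarrow> p \<in> S"
  shows "card {d. d dvd n} ^ 3 \<le> 8 ^ card S * n"
  using assms
proof (induction S arbitrary: n rule: finite_induct)
  case empty
  from empty(2,3) show ?case
  proof (induction n rule: less_induct)
    case (less n)
    show ?case
    proof (cases "n = 1")
      case False
      then obtain p where p: "prime p" "p dvd n" using prime_factor_nat by blast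
      then obtain m where m: "n = p * m" by auto
      have p8: "8 \<le> p" using less.prems(2)[OF p] by (cases "p < 8") auto
      have m0: "0 < m" using m less.prems by auto
      have IH: "card {d. d dvd m} ^ 3 \<le> 8 ^ card ({} :: nat set) * m"
      proof (rule less.IH[OF _ m0])
        show "m < n" using m m0 p8 by simp
        fix q assume "prime q" "q dvd m" "q < 8"
        thus "q \<in> {}" using less.prems(2)[of q] m by simp
      qed
      have "card {d. d dvd n} \<le> card {d. d dvd p} * card {d. d dvd m}"
        unfolding m using m0 p8 by (intro card_divisors_mult_le) auto
      also have "\<dots> \<le> 2 * card {d. d dvd m}"
        using card_divisors_prime_power_le[OF p(1), of 1] by (intro mult_right_mono) auto
      finally have "card {d. d dvd n} ^ 3 \<le> (2 * card {d. d dvd m}) ^ 3" by (rule power_mono) simp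
      also have "\<dots> \<le> p * m"
        using mult_mono[OF p8 IH] by (simp add: power_mult_distrib)
      finally show ?thesis by (simp add: m)
    qed simp
  qed
next
  case (insert p S)
  have p: "prime p" using insert.prems by auto
  obtain m where m: "n = p ^ multiplicity p n * m" "\<not> p dvd m"
    using multiplicity_decompose'[of n p] insert.prems(2) not_prime_unit[of p] p by blast
  define a where "a = multiplicity p n"
  have m0: "0 < m" using m insert.prems(2) by (auto intro: gr0I)
  \<comment> \<open>The full power of p has been split off, so the primes below 8 that divide m
    already lie in S.\<close>
  have IH: "card {d. d dvd m} ^ 3 \<le> 8 ^ card S * m"
  proof (rule insert.IH[OF _ m0])
    fix q assume q: "prime q" "q dvd m" "q < 8"
    have "q dvd n" using q m(1) by (metis dvd_mult)
    thus "q \<in> S" using insert.prems(3)[of q] q m(2) by auto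
  qed (use insert.prems in auto)
  have "card {d. d dvd n} \<le> card {d. d dvd p ^ a} * card {d. d dvd m}"
    unfolding a_def by (subst m(1), rule card_divisors_mult_le) (use m0 p in \<open>auto simp: prime_gt_0_nat\<close>)
  also have "\<dots> \<le> (a + 1) * card {d. d dvd m}"
    using card_divisors_prime_power_le[OF p, of a] by (intro mult_right_mono) auto
  finally have "card {d. d dvd n} ^ 3 \<le> ((a + 1) * card {d. d dvd m}) ^ 3" by (rule power_mono) simp
  also have "\<dots> = (a + 1) ^ 3 * card {d. d dvd m} ^ 3" by (rule power_mult_distrib)
  also have "\<dots> \<le> (8 * 2 ^ a) * (8 ^ card S * m)"
    by (intro mult_mono cube_Suc_le IH) auto
  also have "\<dots> \<le> (8 * p ^ a) * (8 ^ card S * m)"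
    using prime_ge_2_nat[OF p] by (intro mult_right_mono mult_left_mono power_mono) auto
  also have "\<dots> = 8 ^ card (insert p S) * n"
    using insert.hyps by (subst m(1)) (simp add: a_def mult_ac)
  finally show ?case .
qed

text \<open>The primes below 8 are counted crudely as at most 8 of them. This costs 8^8 under the
  cube, which is below 8^9 = 512^3.\<close>

lemma card_divisors_le:
  assumes "0 < n"
  shows "real (card {d. d dvd n}) \<le> 512 * real n powr (1 / 3)"
proof -
  let ?S = "{p. prime p \<and> p < (8 :: nat)}"
  have S: "finite ?S" "card ?S \<le> 8" using card_mono[of "{..<8 :: nat}" ?S] by (auto intro: finite_subset[of _ "{..<8}"])
  have "card {d. d dvd n} ^ 3 \<le> 8 ^ card ?S * n"
    by (rule card_divisors_cube_le_aux[OF S(1) _ assms]) auto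
  also have "\<dots> \<le> 8 ^ 8 * n" using S(2) by (intro mult_right_mono power_increasing) auto
  also have "\<dots> \<le> 512 ^ 3 * n" by simp
  finally have "real (card {d. d dvd n} ^ 3) \<le> real (512 ^ 3 * n)" by (simp only: of_nat_le_iff)
  also have "\<dots> = (512 * real n powr (1 / 3)) ^ 3"
    using assms by (simp add: power_mult_distrib powr_power)
  finally have "real (card {d. d dvd n}) ^ 3 \<le> (512 * real n powr (1 / 3)) ^ 3" by simp
  thus ?thesis by (rule power_le_imp_le_base[where n = 2, simplified]) simp
qed

section \<open>Fourier coefficients at products q h\<close>

definition fourier_sum :: "real measure \<Rightarrow> nat \<Rightarrow> nat \<Rightarrow> real" where
  "fourier_sum \<nu> Q H = (\<Sum>q=Q..2*Q. \<Sum>h=1..H. norm (fourier \<nu> (real (q * h))))"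

text \<open>Group the pairs by n = q h. Since n is positive, q determines h, so the number of pairs
  over n is at most the number of divisors of n.\<close>

lemma sum_products_le:
  fixes F :: "nat \<Rightarrow> real"
  assumes "0 < Q" and F: "\<And>n. 0 \<le> F n"
  shows "(\<Sum>q=Q..2*Q. \<Sum>h=1..H. F (q * h)) \<le> 512 * real (2 * Q * H) powr (1 / 3) * (\<Sum>n\<in>{1..2*Q*H}. F n)"
proof -
  let ?P = "{Q..2*Q} \<times> {1..H}" and ?g = "\<lambda>(q, h). q * h"
  have sub: "?g ` ?P \<subseteq> {1..2*Q*H}"
  proof
    fix n assume "n \<in> ?g ` ?P"
    then obtain q h where *: "q \<in> {Q..2*Q}" "h \<in> {1..H}" and n: "n = q * h" by auto
    hence "q * h \<le> (2 * Q) * H" by (intro mult_mono) auto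
    moreover have "1 \<le> q * h" using * assms by (simp add: Suc_le_eq)
    ultimately show "n \<in> {1..2*Q*H}" by (simp add: n)
  qed
  have "(\<Sum>q=Q..2*Q. \<Sum>h=1..H. F (q * h)) = (\<Sum>z\<in>?P. F (?g z))"
    by (simp add: sum.cartesian_product case_prod_beta)
  also have "\<dots> = (\<Sum>n\<in>{1..2*Q*H}. \<Sum>z\<in>{z\<in>?P. ?g z = n}. F (?g z))"
    by (rule sum.group[symmetric]) (use sub in auto)
  also have "\<dots> = (\<Sum>n\<in>{1..2*Q*H}. real (card {z\<in>?P. ?g z = n}) * F n)"
    by (intro sum.cong) auto
  also have "\<dots> \<le> (\<Sum>n\<in>{1..2*Q*H}. 512 * real (2 * Q * H) powr (1 / 3) * F n)"
  proof (intro sum_mono mult_right_mono F)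
    fix n assume n: "n \<in> {1..2*Q*H}"
    have "card {z\<in>?P. ?g z = n} \<le> card {d. d dvd n}"
    proof (rule card_inj_on_le)
      show "inj_on fst {z\<in>?P. ?g z = n}"
      proof (rule inj_onI)
        fix z w assume *: "z \<in> {z\<in>?P. ?g z = n}" "w \<in> {z\<in>?P. ?g z = n}" "fst z = fst w"
        obtain a b c where [simp]: "z = (a, b)" "w = (a, c)" using *(3) by (cases z, cases w) auto
        have "a * b = a * c" "0 < a" using * n by (auto intro: gr0I)
        thus "z = w" by simp
      qed
      show "fst ` {z\<in>?P. ?g z = n} \<subseteq> {d. d dvd n}" by auto
      show "finite {d. d dvd n}" using n by auto
    qed
    hence "real (card {z\<in>?P. ?g z = n}) \<le> real (card {d. d dvd n})" by simp
    also have "\<dots> \<le> 512 * real n powr (1 / 3)" using n by (intro card_divisors_le) auto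
    also have "\<dots> \<le> 512 * real (2 * Q * H) powr (1 / 3)"
      using n by (intro mult_left_mono powr_mono2) (auto simp del: of_nat_mult)
    finally show "real (card {z\<in>?P. ?g z = n}) \<le> 512 * real (2 * Q * H) powr (1 / 3)" .
  qed
  finally show ?thesis by (simp add: sum_distrib_left)
qed

context digit_measure
begin

lemma sum_fourier_le:
  assumes S: "\<And>\<theta>. 0 \<le> \<theta> \<Longrightarrow> \<theta> < 1 / real B \<Longrightarrow> (\<Sum>d<B. norm (digit_char L (\<theta> + real d / real B))) \<le> S"
    and "N < B ^ m"
  shows "(\<Sum>n\<in>{1..N}. norm (fourier \<nu> (real n))) \<le> S ^ m"
proof -
  have "(\<Sum>n\<in>{1..N}. norm (fourier \<nu> (real n))) \<le> (\<Sum>n<B ^ m. norm (fourier \<nu> (real n)))"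
    using assms(2) by (intro sum_mono2) auto
  also have "\<dots> \<le> (\<Sum>n<B ^ m. \<Prod>j\<in>{1..m}. norm (digit_char L (real n / real B ^ j)))"
    by (intro sum_mono norm_fourier_le_prod)
  also have "\<dots> \<le> S ^ m" using S B by (rule sum_prod_digit_char_le)
  finally show ?thesis .
qed

text \<open>The exponent 19/48 is 1/3 from the divisors plus 1/16 from the digits. The extra factor
  S arises because 2 Q H is squeezed between B^m and B^(m + 1), and m + 1 digits have to be
  summed.\<close>

lemma fourier_sum_le:
  assumes S: "\<And>\<theta>. 0 \<le> \<theta> \<Longrightarrow> \<theta> < 1 / real B \<Longrightarrow> (\<Sum>d<B. norm (digit_char L (\<theta> + real d / real B))) \<le> S"
    and "0 \<le> S" and S16: "S \<le> real B powr (1 / 16)" and Q: "0 < Q" "0 < H"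
  shows "fourier_sum \<nu> Q H \<le> 512 * S * real (2 * Q * H) powr (19 / 48)"
proof -
  let ?N = "2 * Q * H"
  have N: "0 < ?N" using Q by simp
  obtain m where m: "B ^ m \<le> ?N" "?N < B ^ (m + 1)" using ex_power_ivl1[of B ?N] B N by auto
  have Bm: "real B ^ m \<le> real ?N" using m(1) by (metis of_nat_le_iff of_nat_power)
  have "fourier_sum \<nu> Q H \<le> 512 * real ?N powr (1 / 3) * (\<Sum>n\<in>{1..?N}. norm (fourier \<nu> (real n)))"
    unfolding fourier_sum_def using Q by (intro sum_products_le) auto
  also have "\<dots> \<le> 512 * real ?N powr (1 / 3) * S ^ (m + 1)"
    by (intro mult_left_mono sum_fourier_le S m) auto
  also have "S ^ (m + 1) \<le> S * real ?N powr (1 / 16)"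
  proof -
    have "S ^ m \<le> (real B powr (1 / 16)) ^ m" using assms by (intro power_mono) auto
    also have "\<dots> = (real B ^ m) powr (1 / 16)" using B by (simp add: powr_power powr_powr flip: powr_realpow)
    also have "\<dots> \<le> real ?N powr (1 / 16)" using Bm by (intro powr_mono2) auto
    finally show ?thesis using assms(2) by (simp add: mult_left_mono)
  qed
  hence "512 * real ?N powr (1 / 3) * S ^ (m + 1) \<le> 512 * real ?N powr (1 / 3) * (S * real ?N powr (1 / 16))"
    by (intro mult_left_mono) auto
  also have "\<dots> = 512 * S * (real ?N powr (1 / 3) * real ?N powr (1 / 16))" by simp
  also have "real ?N powr (1 / 3) * real ?N powr (1 / 16) = real ?N powr (19 / 48)"
    by (simp flip: powr_add)
  finally show ?thesis .
qed

text \<open>One percent suits the lower count, where the error appears with the factor 30 and must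
  leave at least half of Q.\<close>

lemma fourier_sum_small:
  assumes S: "\<And>\<theta>. 0 \<le> \<theta> \<Longrightarrow> \<theta> < 1 / real B \<Longrightarrow> (\<Sum>d<B. norm (digit_char L (\<theta> + real d / real B))) \<le> S"
    and "0 < S" and S16: "S \<le> real B powr (1 / 16)"
  obtains M where "0 < M" "\<And>Q H. M \<le> real Q \<Longrightarrow> real H \<le> real Q powr (5 / 4) \<Longrightarrow> fourier_sum \<nu> Q H \<le> real Q / 100"
proof
  \<comment> \<open>The power of Q that remains is (9/4) (19/48) = 57/64. The spare Q^(7/64) must
    beat 512 * 2 * 100 * S, and 102400 = 512 * 2 * 100.\<close>
  define M where "M = (102400 * S) powr (64 / 7)"
  show "0 < M" using \<open>0 < S\<close> by (simp add: M_def)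
  fix Q H :: nat assume *: "M \<le> real Q" "real H \<le> real Q powr (5 / 4)"
  have Q: "0 < real Q" using * \<open>0 < M\<close> by simp
  show "fourier_sum \<nu> Q H \<le> real Q / 100"
  proof (cases "H = 0")
    case True
    thus ?thesis by (simp add: fourier_sum_def)
  next
    case False
    have "fourier_sum \<nu> Q H \<le> 512 * S * real (2 * Q * H) powr (19 / 48)"
      using assms False Q by (intro fourier_sum_le) auto
    also have "real (2 * Q * H) powr (19 / 48) \<le> (2 * real Q powr (9 / 4)) powr (19 / 48)"
    proof (rule powr_mono2)
      have "real (2 * Q * H) \<le> 2 * (real Q powr 1 * real Q powr (5 / 4))"
        using * Q by (simp add: mult_left_mono)
      also have "real Q powr 1 * real Q powr (5 / 4) = real Q powr (9 / 4)"
        by (subst powr_add[symmetric]) simp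
      finally show "real (2 * Q * H) \<le> 2 * real Q powr (9 / 4)" .
    qed auto
    also have "\<dots> = 2 powr (19 / 48) * real Q powr (57 / 64)"
      by (simp add: powr_mult powr_powr)
    also have "\<dots> \<le> 2 * real Q powr (57 / 64)"
      using powr_mono[of "19 / 48" 1 "2 :: real"] by (intro mult_right_mono) auto
    also have "512 * S * (2 * real Q powr (57 / 64)) = (102400 * S) * real Q powr (57 / 64) / 100" by simp
    also have "102400 * S = M powr (7 / 64)" using \<open>0 < S\<close> by (simp add: M_def powr_powr)
    also have "M powr (7 / 64) \<le> real Q powr (7 / 64)" using * \<open>0 < M\<close> by (intro powr_mono2) auto
    also have "real Q powr (7 / 64) * real Q powr (57 / 64) = real Q"
      using Q by (subst powr_add[symmetric]) simp
    finally show ?thesis using \<open>0 < S\<close> by (simp add: mult_left_mono mult_right_mono divide_right_mono)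
  qed
qed

end

section \<open>Counting by trigonometric majorants and minorants\<close>

text \<open>The one-dimensional counterpart of \<open>approx_set\<close>; products of such sets
  enclose the Euclidean neighbourhood from inside and outside.\<close>

definition near_set :: "real \<Rightarrow> nat \<Rightarrow> real \<Rightarrow> real set" where
  "near_set \<rho> q \<gamma> = {x. \<exists>z::int. \<bar>real q * x - \<gamma> - of_int z\<bar> \<le> \<rho>}"

lemma near_set_borel [measurable]: "near_set \<rho> q \<gamma> \<in> sets borel"
proof -
  have "near_set \<rho> q \<gamma> = (\<Union>z::int. {x. \<bar>real q * x - \<gamma> - of_int z\<bar> \<le> \<rho>})"
    by (auto simp: near_set_def)
  also have "\<dots> \<in> sets borel" by measurable
  finally show ?thesis .
qed

text \<open>Only squared moduli are integrated, so the frequencies may start at 0 instead of being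
  symmetric.\<close>

definition trig_poly :: "(nat \<Rightarrow> real) \<Rightarrow> nat \<Rightarrow> real \<Rightarrow> complex" where
  "trig_poly a N y = (\<Sum>s<N. of_real (a s) * cis (2 * pi * real s * y))"

lemma trig_poly_add_int: "trig_poly a N (y + of_int z) = trig_poly a N y"
proof -
  have "cis (2 * pi * real s * (y + of_int z)) = cis (2 * pi * real s * y)" for s
  proof -
    have "cis (2 * pi * real s * (y + of_int z)) = cis (2 * pi * real s * y) * cis (2 * pi * of_int (int s * z))"
      by (simp add: cis_mult algebra_simps)
    thus ?thesis by (simp only: cis_int) simp
  qed
  thus ?thesis by (simp add: trig_poly_def)
qed

lemma norm_trig_poly_le: "norm (trig_poly a N y) \<le> (\<Sum>s<N. \<bar>a s\<bar>)"
  unfolding trig_poly_def by (rule order_trans[OF norm_sum]) (simp add: norm_mult)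

lemma norm_trig_poly_square:
  "(norm (trig_poly a N y))\<^sup>2 = (\<Sum>s<N. \<Sum>t<N. a s * a t * cos (2 * pi * (real s - real t) * y))"
proof -
  have re: "Re (trig_poly a N y) = (\<Sum>s<N. a s * cos (2 * pi * real s * y))"
    and im: "Im (trig_poly a N y) = (\<Sum>s<N. a s * sin (2 * pi * real s * y))"
    by (simp_all add: trig_poly_def)
  have eq: "cos (2 * pi * (real s - real t) * y) =
      cos (2 * pi * real s * y) * cos (2 * pi * real t * y) + sin (2 * pi * real s * y) * sin (2 * pi * real t * y)" for s t
    using cos_diff[of "2 * pi * real s * y" "2 * pi * real t * y"] by (simp add: algebra_simps)
  have "(norm (trig_poly a N y))\<^sup>2 =
      (\<Sum>s<N. \<Sum>t<N. (a s * cos (2 * pi * real s * y)) * (a t * cos (2 * pi * real t * y)) +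
        (a s * sin (2 * pi * real s * y)) * (a t * sin (2 * pi * real t * y)))"
    unfolding cmod_power2 re im unfolding power2_eq_square sum_product sum.distrib ..
  also have "\<dots> = (\<Sum>s<N. \<Sum>t<N. a s * a t * cos (2 * pi * (real s - real t) * y))"
    unfolding eq by (intro sum.cong refl) (simp add: distrib_left mult_ac)
  finally show ?thesis .
qed

context digit_measure
begin

lemma integrable_indicator_near_set [simp]: "integrable \<nu> (indicat_real (near_set \<rho> q \<gamma>))"
  by (rule integrable_const_bound[where B = 1]) (auto simp: indicator_def)

lemma integrable_cos: "integrable \<nu> (\<lambda>x. cos (a * (b * x - c)))"
  by (rule integrable_const_bound[where B = 1]) auto

text \<open>The shift by gamma contributes a unimodular factor, which disappears in the norm; this
  makes all later estimates uniform in gamma.\<close>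

lemma abs_integral_cos_le:
  "\<bar>\<integral>x. cos (2 * pi * real k * (real q * x - \<gamma>)) \<partial>\<nu>\<bar> \<le> norm (fourier \<nu> (real (q * k)))"
proof -
  have int: "integrable \<nu> (\<lambda>x. cis (a * x + b))" for a b
    by (rule integrable_cis_affine[OF prob_space_axioms sets_eq])
  have eq: "cis (2 * pi * real k * (real q * x - \<gamma>)) = cis (- (2 * pi * real k * \<gamma>)) * cis (2 * pi * real (q * k) * x)" for x
    by (simp add: cis_mult algebra_simps)
  have "(\<integral>x. cos (2 * pi * real k * (real q * x - \<gamma>)) \<partial>\<nu>) = (\<integral>x. Re (cis (2 * pi * real k * (real q * x - \<gamma>))) \<partial>\<nu>)"
    by simp
  also have "\<dots> = Re (\<integral>x. cis (2 * pi * real k * (real q * x - \<gamma>)) \<partial>\<nu>)"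
    using int[of "2 * pi * real k * real q" "- (2 * pi * real k * \<gamma>)"]
    by (intro integral_Re) (simp add: algebra_simps)
  also have "\<dots> = Re (cis (- (2 * pi * real k * \<gamma>)) * fourier \<nu> (real (q * k)))"
    unfolding eq fourier_def by simp
  also have "\<bar>\<dots>\<bar> \<le> norm (cis (- (2 * pi * real k * \<gamma>)) * fourier \<nu> (real (q * k)))"
    by (rule abs_Re_le_cmod)
  finally show ?thesis by (simp add: norm_mult)
qed

text \<open>The diagonal terms give the Parseval value. In each row s, a difference of absolute
  value h occurs at most twice off the diagonal, once for t < s and once for t > s, hence the factor
  2.\<close>

lemma integral_trig_poly_square:
  assumes a: "\<And>s. s < N \<Longrightarrow> \<bar>a s\<bar> \<le> A" and "0 \<le> A"
  shows "\<bar>(\<integral>x. (norm (trig_poly a N (real q * x - \<gamma>)))\<^sup>2 \<partial>\<nu>) - (\<Sum>s<N. (a s)\<^sup>2)\<bar>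
      \<le> A\<^sup>2 * real N * (2 * (\<Sum>h=1..<N. norm (fourier \<nu> (real (q * h)))))"
proof -
  define F where "F h = norm (fourier \<nu> (real (q * h)))" for h
  define u where "u s t = (\<integral>x. cos (2 * pi * (real s - real t) * (real q * x - \<gamma>)) \<partial>\<nu>)" for s t :: nat
  have uss: "u s s = 1" for s using prob_space by (simp add: u_def)
  have u1: "\<bar>u s t\<bar> \<le> F (s - t)" if "t < s" for s t
    using abs_integral_cos_le[of "s - t" q \<gamma>] that by (simp add: u_def F_def of_nat_diff)
  have usym: "u s t = u t s" for s t
  proof -
    have "cos (2 * pi * (real s - real t) * y) = cos (2 * pi * (real t - real s) * y)" for y
      by (subst cos_minus[symmetric]) (simp add: algebra_simps)
    thus ?thesis by (simp add: u_def)
  qed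
  have "(\<integral>x. (norm (trig_poly a N (real q * x - \<gamma>)))\<^sup>2 \<partial>\<nu>) = (\<Sum>s<N. \<Sum>t<N. a s * a t * u s t)"
    unfolding norm_trig_poly_square u_def
    by (simp add: integrable_cos)
  also have "\<dots> = (\<Sum>s<N. (a s)\<^sup>2 + (\<Sum>t\<in>{..<N} - {s}. a s * a t * u s t))"
    by (intro sum.cong[OF refl], subst sum.remove) (auto simp: uss power2_eq_square)
  also have "\<dots> - (\<Sum>s<N. (a s)\<^sup>2) = (\<Sum>s<N. \<Sum>t\<in>{..<N} - {s}. a s * a t * u s t)"
    by (simp add: sum.distrib)
  also have "\<bar>\<dots>\<bar> \<le> (\<Sum>s<N. A\<^sup>2 * (2 * (\<Sum>h=1..<N. F h)))"
  proof (rule order_trans[OF sum_abs], rule sum_mono)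
    fix s assume s: "s \<in> {..<N}"
    have "\<bar>\<Sum>t\<in>{..<N} - {s}. a s * a t * u s t\<bar> \<le> (\<Sum>t\<in>{..<N} - {s}. A\<^sup>2 * \<bar>u s t\<bar>)"
    proof (rule order_trans[OF sum_abs], rule sum_mono)
      fix t assume "t \<in> {..<N} - {s}"
      hence "\<bar>a s\<bar> * \<bar>a t\<bar> \<le> A * A" using s assms by (intro mult_mono) auto
      thus "\<bar>a s * a t * u s t\<bar> \<le> A\<^sup>2 * \<bar>u s t\<bar>"
        by (simp add: abs_mult power2_eq_square mult_right_mono)
    qed
    also have "\<dots> = A\<^sup>2 * (\<Sum>t\<in>{..<N} - {s}. \<bar>u s t\<bar>)" by (simp add: sum_distrib_left)
    also have "(\<Sum>t\<in>{..<N} - {s}. \<bar>u s t\<bar>) = (\<Sum>t\<in>{..<s}. \<bar>u s t\<bar>) + (\<Sum>t\<in>{s<..<N}. \<bar>u s t\<bar>)"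
    proof -
      have eq: "{..<N} - {s} = {..<s} \<union> {s<..<N}" using s by auto
      show ?thesis by (subst eq, rule sum.union_disjoint) auto
    qed
    also have "(\<Sum>t\<in>{..<s}. \<bar>u s t\<bar>) \<le> (\<Sum>h=1..<N. F h)"
    proof -
      have "(\<Sum>t\<in>{..<s}. \<bar>u s t\<bar>) \<le> (\<Sum>t\<in>{..<s}. F (s - t))" by (intro sum_mono u1) auto
      also have "\<dots> = (\<Sum>h\<in>{1..s}. F h)"
        by (rule sum.reindex_bij_witness[of _ "\<lambda>h. s - h" "\<lambda>t. s - t"]) auto
      also have "\<dots> \<le> (\<Sum>h=1..<N. F h)" using s by (intro sum_mono2) (auto simp: F_def)
      finally show ?thesis .
    qed
    also have "(\<Sum>t\<in>{s<..<N}. \<bar>u s t\<bar>) \<le> (\<Sum>h=1..<N. F h)"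
    proof -
      have "(\<Sum>t\<in>{s<..<N}. \<bar>u s t\<bar>) \<le> (\<Sum>t\<in>{s<..<N}. F (t - s))"
        by (intro sum_mono, subst usym, rule u1) auto
      also have "\<dots> = (\<Sum>h\<in>{1..<N - s}. F h)"
        by (rule sum.reindex_bij_witness[of _ "\<lambda>h. h + s" "\<lambda>t. t - s"]) auto
      also have "\<dots> \<le> (\<Sum>h=1..<N. F h)" using s by (intro sum_mono2) (auto simp: F_def)
      finally show ?thesis .
    qed
    finally show "\<bar>\<Sum>t\<in>{..<N} - {s}. a s * a t * u s t\<bar> \<le> A\<^sup>2 * (2 * (\<Sum>h=1..<N. F h))"
      by (simp add: mult_left_mono)
  qed
  finally show ?thesis by (simp add: F_def mult_ac)
qed

lemma integrable_trig_poly_square: "integrable \<nu> (\<lambda>x. (norm (trig_poly a N (real q * x - \<gamma>)))\<^sup>2)"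
  unfolding norm_trig_poly_square by (intro Bochner_Integration.integrable_sum integrable_mult_right integrable_cos)

text \<open>The majorant is a multiple of the Fejer kernel. The condition on K keeps all phases 2 pi
  s y within pi / 3, where the cosine is at least 1/2, so the polynomial has modulus at least K / 2
  on the set. The alternative K = 1, where the polynomial is constant, covers large radii.\<close>

lemma prob_near_set_le:
  assumes K: "0 < K" "K = 1 \<or> 6 * real K * \<delta> \<le> 1"
  shows "prob (near_set \<delta> q \<gamma>) \<le> 4 / real K * (1 + 2 * (\<Sum>h=1..<K. norm (fourier \<nu> (real (q * h)))))"
proof -
  let ?W = "\<lambda>x. trig_poly (\<lambda>_. 1) K (real q * x - \<gamma>)"
  let ?F = "\<Sum>h=1..<K. norm (fourier \<nu> (real (q * h)))"
  have ge: "(real K)\<^sup>2 / 4 * indicator (near_set \<delta> q \<gamma>) x \<le> (norm (?W x))\<^sup>2" for x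
  proof (cases "x \<in> near_set \<delta> q \<gamma>")
    case True
    then obtain z :: int where z: "\<bar>real q * x - \<gamma> - of_int z\<bar> \<le> \<delta>" by (auto simp: near_set_def)
    define y where "y = real q * x - \<gamma> - of_int z"
    have "?W x = trig_poly (\<lambda>_. 1) K (y + of_int z)" by (simp add: y_def)
    hence W: "?W x = trig_poly (\<lambda>_. 1) K y" by (simp only: trig_poly_add_int)
    have "(\<Sum>s<K. 1 / 2) \<le> (\<Sum>s<K. cos (2 * pi * real s * y))"
    proof (rule sum_mono)
      fix s assume s: "s \<in> {..<K}"
      have "6 * (real s * \<bar>y\<bar>) \<le> 1"
      proof (cases "K = 1")
        case False
        have "6 * (real s * \<bar>y\<bar>) \<le> 6 * (real K * \<delta>)"
          using s z by (intro mult_left_mono mult_mono) (auto simp: y_def)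
        thus ?thesis using K False by simp
      qed (use s in auto)
      hence "pi * (6 * (real s * \<bar>y\<bar>)) \<le> pi * 1" by (intro mult_left_mono) auto
      moreover have "\<bar>2 * pi * real s * y\<bar> = pi * (6 * (real s * \<bar>y\<bar>)) / 3" by (simp add: abs_mult)
      ultimately have "\<bar>2 * pi * real s * y\<bar> \<le> pi / 3" by linarith
      hence "cos (pi / 3) \<le> cos \<bar>2 * pi * real s * y\<bar>" by (intro cos_monotone_0_pi_le) auto
      thus "1 / 2 \<le> cos (2 * pi * real s * y)" by (simp add: cos_60)
    qed
    also have "\<dots> = Re (trig_poly (\<lambda>_. 1) K y)" by (simp add: trig_poly_def)
    also have "\<dots> = Re (?W x)" by (simp only: W)
    also have "\<dots> \<le> norm (?W x)" by (rule complex_Re_le_cmod)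
    finally have "(real K / 2)\<^sup>2 \<le> (norm (?W x))\<^sup>2" by (intro power_mono) auto
    thus ?thesis using True by (simp add: power_divide)
  qed simp
  have "(real K)\<^sup>2 / 4 * prob (near_set \<delta> q \<gamma>) = (\<integral>x. (real K)\<^sup>2 / 4 * indicator (near_set \<delta> q \<gamma>) x \<partial>\<nu>)"
    by simp
  also have "\<dots> \<le> (\<integral>x. (norm (?W x))\<^sup>2 \<partial>\<nu>)"
    by (intro integral_mono integrable_trig_poly_square ge) auto
  also have "\<dots> \<le> real K + real K * (2 * ?F)"
    using integral_trig_poly_square[of K "\<lambda>_. 1" 1 q \<gamma>] by simp
  finally have "(real K)\<^sup>2 / 4 * prob (near_set \<delta> q \<gamma>) \<le> real K * (1 + 2 * ?F)" by (simp add: algebra_simps)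
  hence "real K * (real K * prob (near_set \<delta> q \<gamma>)) \<le> real K * (4 * (1 + 2 * ?F))"
    by (simp add: power2_eq_square algebra_simps)
  hence "real K * prob (near_set \<delta> q \<gamma>) \<le> 4 * (1 + 2 * ?F)"
    using K by (subst (asm) mult_le_cancel_left_pos) auto
  thus ?thesis using K by (simp add: field_simps)
qed

end

text \<open>Summation by parts: multiplication by 1 - e(y) takes differences of the coefficients. At
  s = 0 natural subtraction makes the difference 0, which equals \<open>a 0\<close> by
  assumption.\<close>

lemma trig_poly_telescope:
  assumes "a 0 = 0"
  shows "trig_poly (\<lambda>s. a s - a (s - 1)) (Suc N) y =
    (1 - cis (2 * pi * y)) * trig_poly a N y + of_real (a N) * cis (2 * pi * real N * y)"
proof (induction N)
  case 0
  thus ?case using assms by (simp add: trig_poly_def)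
next
  case (Suc N)
  have c: "cis (2 * pi * real (Suc N) * y) = cis (2 * pi * y) * cis (2 * pi * real N * y)"
    by (simp add: cis_mult algebra_simps)
  have "trig_poly (\<lambda>s. a s - a (s - 1)) (Suc (Suc N)) y = trig_poly (\<lambda>s. a s - a (s - 1)) (Suc N) y +
      of_real (a (Suc N) - a N) * cis (2 * pi * real (Suc N) * y)"
    unfolding trig_poly_def by simp
  moreover have "trig_poly a (Suc N) y = trig_poly a N y + of_real (a N) * cis (2 * pi * real N * y)"
    unfolding trig_poly_def by simp
  ultimately show ?case unfolding Suc c by (simp add: algebra_simps)
qed

lemma sum_squares_ge: "real K ^ 3 \<le> 3 * (\<Sum>s\<le>K. (real s)\<^sup>2)"
proof (induction K)
  case (Suc K)
  have "real (Suc K) ^ 3 \<le> real K ^ 3 + 3 * (real (Suc K))\<^sup>2"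
    by (simp add: power3_eq_cube power2_eq_square algebra_simps)
  thus ?case using Suc by simp
qed simp

context digit_measure
begin

text \<open>
  If \<open>W\<close> is a trigonometric polynomial in \<open>e(y)\<close>, then
  \<open>\<bar>W\<bar>\<^sup>2 - \<bar>(1 - e(y)) W\<bar>\<^sup>2 / (4 \<rho>\<^sup>2)\<close> is nonpositive as soon as \<open>y\<close> has distance more than
  \<open>\<rho>\<close> from the integers. For the triangular coefficients below, \<open>(1 - e(y)) W\<close> has coefficients
  \<open>\<plusminus>1\<close>, so the mean of this minorant stays positive for \<open>K\<close> of order \<open>1 / \<rho>\<close>.
\<close>

lemma prob_near_set_ge:
  assumes K: "0 < K" "2 \<le> real K * \<rho>" and "0 < \<rho>"
  shows "prob (near_set \<rho> q \<gamma>) \<ge> (1 / 5 - 6 * (\<Sum>h=1..2*K. norm (fourier \<nu> (real (q * h))))) / real K"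
proof -
  \<comment> \<open>A hat function with peak K at s = K. It vanishes at both 0 and 2 K, so the
    boundary term in \<open>trig_poly_telescope\<close> drops out.\<close>
  define a where "a s = real (min s (2 * K - s))" for s
  define b where "b s = a s - a (s - 1)" for s
  let ?W = "\<lambda>x. trig_poly a (2 * K) (real q * x - \<gamma>)"
  let ?V = "\<lambda>x. trig_poly b (Suc (2 * K)) (real q * x - \<gamma>)"
  let ?F = "\<Sum>h=1..2*K. norm (fourier \<nu> (real (q * h)))"
  have F0: "0 \<le> ?F" by (intro sum_nonneg) auto
  have a_le: "\<bar>a s\<bar> \<le> real K" for s by (auto simp: a_def min_def)
  have b_le: "\<bar>b s\<bar> \<le> 1" for s by (auto simp: a_def b_def min_def)
  have V: "?V x = (1 - cis (2 * pi * (real q * x - \<gamma>))) * ?W x" for x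
    unfolding b_def by (subst trig_poly_telescope) (auto simp: a_def)
  \<comment> \<open>The ascending half of the hat is enough for the main term.\<close>
  have sum_a: "real K ^ 3 / 3 \<le> (\<Sum>s<2*K. (a s)\<^sup>2)"
  proof -
    have "(\<Sum>s\<le>K. (real s)\<^sup>2) = (\<Sum>s\<le>K. (a s)\<^sup>2)" by (intro sum.cong) (auto simp: a_def)
    also have "\<dots> \<le> (\<Sum>s<2*K. (a s)\<^sup>2)" 
      using K by (intro sum_mono2) auto
    finally show ?thesis using sum_squares_ge[of K] by simp
  qed
  \<comment> \<open>Natural subtraction gives \<open>b 0 = 0\<close>, leaving 2 K coefficients of
    modulus at most 1.\<close>
  have sum_b: "(\<Sum>s<Suc (2*K). (b s)\<^sup>2) \<le> 2 * real K"
  proof -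
    have "(\<Sum>s<Suc (2*K). (b s)\<^sup>2) \<le> (\<Sum>s<Suc (2*K). if s = 0 then 0 else 1)"
      using b_le by (intro sum_mono) (auto simp: abs_square_le_1, auto simp: b_def)
    also have "\<dots> = 2 * real K" by (subst sum.lessThan_Suc_shift) simp
    finally show ?thesis .
  qed
  have le: "(norm (?W x))\<^sup>2 - (norm (?V x))\<^sup>2 / (4 * \<rho>\<^sup>2) \<le> real K ^ 4 * indicator (near_set \<rho> q \<gamma>) x" for x
  proof (cases "x \<in> near_set \<rho> q \<gamma>")
    case True
    have "norm (?W x) \<le> (\<Sum>s<2*K. \<bar>a s\<bar>)" by (rule norm_trig_poly_le)
    also have "\<dots> = (\<Sum>s<K. real s) + (\<Sum>s<K. real (K - s))"
    proof -
      have "(\<Sum>s<2*K. \<bar>a s\<bar>) = (\<Sum>s<K. \<bar>a s\<bar>) + (\<Sum>s=K..<2*K. \<bar>a s\<bar>)"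
      proof -
        have eq: "{..<2*K} = {..<K} \<union> {K..<2*K}" by auto
        show ?thesis by (subst eq, rule sum.union_disjoint) auto
      qed
      also have "(\<Sum>s<K. \<bar>a s\<bar>) = (\<Sum>s<K. real s)" by (intro sum.cong) (auto simp: a_def)
      also have "(\<Sum>s=K..<2*K. \<bar>a s\<bar>) = (\<Sum>s<K. real (K - s))"
        by (rule sum.reindex_bij_witness[of _ "\<lambda>s. s + K" "\<lambda>s. s - K"]) (auto simp: a_def)
      finally show ?thesis .
    qed
    also have "\<dots> = (\<Sum>s<K. real K)" by (subst sum.distrib[symmetric]) (auto simp: of_nat_diff)
    also have "\<dots> = (real K)\<^sup>2" by (simp add: power2_eq_square)
    finally have "(norm (?W x))\<^sup>2 \<le> ((real K)\<^sup>2)\<^sup>2" by (rule power_mono) simp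
    moreover have "0 \<le> (norm (?V x))\<^sup>2 / (4 * \<rho>\<^sup>2)" by simp
    ultimately have "(norm (?W x))\<^sup>2 - (norm (?V x))\<^sup>2 / (4 * \<rho>\<^sup>2) \<le> ((real K)\<^sup>2)\<^sup>2" by linarith
    thus ?thesis using True by (simp flip: power_mult)
  next
    case False
    define y where "y = real q * x - \<gamma>"
    define t where "t = y - of_int (round y)"
    have t: "\<bar>t\<bar> \<le> 1 / 2" using of_int_round_abs_le[of y] by (simp add: t_def abs_minus_commute)
    have "\<not> \<bar>t\<bar> \<le> \<rho>" using False by (auto simp: near_set_def t_def y_def)
    moreover have "cis (2 * pi * y) = cis (2 * pi * t)"
    proof -
      have "cis (2 * pi * y) = cis (2 * pi * t) * cis (2 * pi * of_int (round y))"
        by (simp add: cis_mult t_def algebra_simps)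
      thus ?thesis by (simp only: cis_int) simp
    qed
    ultimately have "2 * \<rho> \<le> norm (1 - cis (2 * pi * y))"
      using norm_one_minus_cis_ge[OF t] by simp
    hence "(2 * \<rho>)\<^sup>2 \<le> (norm (1 - cis (2 * pi * y)))\<^sup>2" using \<open>0 < \<rho>\<close> by (intro power_mono) auto
    hence "(2 * \<rho>)\<^sup>2 * (norm (?W x))\<^sup>2 \<le> (norm (1 - cis (2 * pi * y)))\<^sup>2 * (norm (?W x))\<^sup>2"
      by (rule mult_right_mono) simp
    also have "\<dots> = (norm (?V x))\<^sup>2"
      unfolding V y_def by (simp add: norm_mult power_mult_distrib)
    finally have "(norm (?W x))\<^sup>2 \<le> (norm (?V x))\<^sup>2 / (4 * \<rho>\<^sup>2)"
      using \<open>0 < \<rho>\<close> by (simp add: field_simps power2_eq_square)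
    thus ?thesis using False by simp
  qed
  have "(\<integral>x. (norm (?W x))\<^sup>2 \<partial>\<nu>) - (\<integral>x. (norm (?V x))\<^sup>2 \<partial>\<nu>) / (4 * \<rho>\<^sup>2) =
      (\<integral>x. (norm (?W x))\<^sup>2 - (norm (?V x))\<^sup>2 / (4 * \<rho>\<^sup>2) \<partial>\<nu>)"
    by (simp add: integrable_trig_poly_square)
  also have "\<dots> \<le> (\<integral>x. real K ^ 4 * indicator (near_set \<rho> q \<gamma>) x \<partial>\<nu>)"
    by (intro integral_mono le Bochner_Integration.integrable_diff integrable_divide integrable_trig_poly_square) auto
  also have "\<dots> = real K ^ 4 * prob (near_set \<rho> q \<gamma>)" by simp
  finally have main: "(\<integral>x. (norm (?W x))\<^sup>2 \<partial>\<nu>) - (\<integral>x. (norm (?V x))\<^sup>2 \<partial>\<nu>) / (4 * \<rho>\<^sup>2) \<le> real K ^ 4 * prob (near_set \<rho> q \<gamma>)" .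
  have W: "real K ^ 3 / 3 - 4 * real K ^ 3 * ?F \<le> (\<integral>x. (norm (?W x))\<^sup>2 \<partial>\<nu>)"
  proof -
    have "(\<Sum>h=1..<2*K. norm (fourier \<nu> (real (q * h)))) \<le> ?F" by (intro sum_mono2) auto
    hence "(real K)\<^sup>2 * real (2 * K) * (2 * (\<Sum>h=1..<2*K. norm (fourier \<nu> (real (q * h))))) \<le>
       (real K)\<^sup>2 * real (2 * K) * (2 * ?F)" by (intro mult_left_mono) auto
    also have "\<dots> = 4 * real K ^ 3 * ?F" by (simp add: power2_eq_square power3_eq_cube)
    finally show ?thesis
      using integral_trig_poly_square[of "2 * K" a "real K" q \<gamma>] a_le sum_a by force
  qed
  have "(\<integral>x. (norm (?V x))\<^sup>2 \<partial>\<nu>) \<le> 2 * real K + 6 * real K * ?F"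
  proof -
    have "(\<integral>x. (norm (?V x))\<^sup>2 \<partial>\<nu>) \<le> 2 * real K + real (Suc (2 * K)) * (2 * ?F)"
      using integral_trig_poly_square[of "Suc (2 * K)" b 1 q \<gamma>] b_le sum_b
      by (simp add: atLeastLessThanSuc_atLeastAtMost)
    also have "real (Suc (2 * K)) * (2 * ?F) \<le> (3 * real K) * (2 * ?F)"
      using K F0 by (intro mult_right_mono) auto
    finally show ?thesis by simp
  qed
  hence "(\<integral>x. (norm (?V x))\<^sup>2 \<partial>\<nu>) / (4 * \<rho>\<^sup>2) \<le> (2 * real K + 6 * real K * ?F) / (4 * \<rho>\<^sup>2)"
    by (rule divide_right_mono) simp
  also have "\<dots> = (2 * real K + 6 * real K * ?F) * (1 / (4 * \<rho>\<^sup>2))" by simp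
  \<comment> \<open>As \<rho> is at least 2 / K, the subtracted mean has main term at most 2 K * K^2
    / 16 = K^3 / 8, safely below the K^3 / 3 of the hat.\<close>
  also have "1 / (4 * \<rho>\<^sup>2) \<le> (real K)\<^sup>2 / 16"
  proof -
    have "2\<^sup>2 \<le> (real K * \<rho>)\<^sup>2" using K by (intro power_mono) auto
    thus ?thesis using \<open>0 < \<rho>\<close> by (simp add: field_simps power_mult_distrib)
  qed
  hence "(2 * real K + 6 * real K * ?F) * (1 / (4 * \<rho>\<^sup>2)) \<le> (2 * real K + 6 * real K * ?F) * ((real K)\<^sup>2 / 16)"
    using F0 by (intro mult_left_mono) auto
  also have "\<dots> = real K ^ 3 / 8 + 3 / 8 * real K ^ 3 * ?F"
    by (simp add: power2_eq_square power3_eq_cube algebra_simps)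
  finally have "real K ^ 3 / 3 - 4 * real K ^ 3 * ?F - (real K ^ 3 / 8 + 3 / 8 * real K ^ 3 * ?F) \<le> real K ^ 4 * prob (near_set \<rho> q \<gamma>)"
    using main W by linarith
  \<comment> \<open>The constants are rounded: 1/3 - 1/8 = 5/24 exceeds 1/5, and 4 + 3/8 = 35/8 is
    below 6.\<close>
  moreover have "real K ^ 3 * (1 / 5 - 6 * ?F) \<le> real K ^ 3 / 3 - 4 * real K ^ 3 * ?F - (real K ^ 3 / 8 + 3 / 8 * real K ^ 3 * ?F)"
  proof -
    have "0 \<le> real K ^ 3 * (5 / 24 - 1 / 5) + real K ^ 3 * ?F * (6 - 35 / 8)"
      using F0 by (intro add_nonneg_nonneg mult_nonneg_nonneg) auto
    thus ?thesis by (simp add: algebra_simps)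
  qed
  ultimately have "real K ^ 3 * (1 / 5 - 6 * ?F) \<le> real K ^ 3 * (real K * prob (near_set \<rho> q \<gamma>))"
    by (simp add: power_numeral_reduce mult_ac)
  hence "1 / 5 - 6 * ?F \<le> real K * prob (near_set \<rho> q \<gamma>)"
    using K by (subst (asm) mult_le_cancel_left_pos) auto
  thus ?thesis using K by (subst pos_divide_le_eq) (auto simp: mult.commute)
qed

end

section \<open>Ahlfors regularity\<close>

text \<open>These are the integers with m digits in base B, all below L; dividing by B^m gives the
  left endpoints of the level-m intervals. The new digit takes the most significant place because
  one step of self-similarity exposes the first digit of the expansion.\<close>

primrec prefixes :: "nat \<Rightarrow> nat \<Rightarrow> nat \<Rightarrow> nat set" where
  "prefixes B L 0 = {0}"
| "prefixes B L (Suc m) = (\<lambda>(y, d). y + d * B ^ m) ` (prefixes B L m \<times> {..<L})"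

lemma finite_prefixes [simp]: "finite (prefixes B L m)"
  by (induction m) auto

lemma prefixes_less: "L \<le> B \<Longrightarrow> y \<in> prefixes B L m \<Longrightarrow> y < B ^ m"
proof (induction m arbitrary: y)
  case (Suc m)
  then obtain z d where y: "y = z + d * B ^ m" "z \<in> prefixes B L m" "d < L" by auto
  have "z + d * B ^ m < (d + 1) * B ^ m" using Suc.IH[OF Suc.prems(1) y(2)] by simp
  also have "\<dots> \<le> B * B ^ m" using y Suc.prems by (intro mult_right_mono) auto
  finally show ?case by (simp add: y)
qed simp

lemma inj_on_prefixes:
  assumes "L \<le> B" "0 < B"
  shows "inj_on (\<lambda>(y, d). y + d * B ^ m) (prefixes B L m \<times> {..<L})"
proof (rule inj_on_inverseI[where g = "\<lambda>n. (n mod B ^ m, n div B ^ m)"])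
  fix z assume "z \<in> prefixes B L m \<times> {..<L}"
  then obtain y d where "z = (y, d)" "y < B ^ m" using prefixes_less[OF assms(1)] by blast
  thus "(\<lambda>n. (n mod B ^ m, n div B ^ m)) ((\<lambda>(y, d). y + d * B ^ m) z) = z" using assms by simp
qed

context digit_measure
begin

text \<open>The preimage of A under the level-m branch with prefix y; its probability is the share
  of that branch lying in A.\<close>

abbreviation cyl :: "nat \<Rightarrow> nat \<Rightarrow> real set \<Rightarrow> real set" where
  "cyl m y A \<equiv> {t. (t + real y) / real B ^ m \<in> A}"

lemma cyl_borel: "A \<in> sets borel \<Longrightarrow> cyl m y A \<in> sets borel"
  using measurable_sets_borel[of "\<lambda>t. (t + real y) / real B ^ m" borel A] by (simp add: vimage_def)

lemma prob_UNIV [simp]: "prob UNIV = 1"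
  using prob_space by simp

lemma prob_prefixes:
  assumes "A \<in> sets borel"
  shows "prob A = (\<Sum>y\<in>prefixes B L m. prob (cyl m y A)) / real L ^ m"
  using assms
proof (induction m arbitrary: A)
  case (Suc m)
  have "prob A = (\<Sum>d<L. prob (cyl 1 d A)) / real L"
    using prob_step[OF Suc.prems] by simp
  also have "(\<Sum>d<L. prob (cyl 1 d A)) =
      (\<Sum>d<L. (\<Sum>y\<in>prefixes B L m. prob (cyl (Suc m) (y + d * B ^ m) A)) / real L ^ m)"
  proof (rule sum.cong[OF refl])
    fix d
    have "((t + real y) / real B ^ m + real d) / real B ^ 1 = (t + real (y + d * B ^ m)) / real B ^ Suc m" for t y
      using B by (simp add: field_simps)
    hence "cyl m y (cyl 1 d A) = cyl (Suc m) (y + d * B ^ m) A" for y by simp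
    thus "prob (cyl 1 d A) = (\<Sum>y\<in>prefixes B L m. prob (cyl (Suc m) (y + d * B ^ m) A)) / real L ^ m"
      by (subst Suc.IH[OF cyl_borel[OF Suc.prems]]) simp
  qed
  also have "\<dots> = (\<Sum>d<L. \<Sum>y\<in>prefixes B L m. prob (cyl (Suc m) (y + d * B ^ m) A)) / real L ^ m"
    by (simp add: sum_divide_distrib)
  also have "(\<Sum>d<L. \<Sum>y\<in>prefixes B L m. prob (cyl (Suc m) (y + d * B ^ m) A)) =
      (\<Sum>(y, d)\<in>prefixes B L m \<times> {..<L}. prob (cyl (Suc m) (y + d * B ^ m) A))"
    by (subst sum.swap) (simp add: sum.cartesian_product)
  also have "\<dots> = (\<Sum>y\<in>prefixes B L (Suc m). prob (cyl (Suc m) y A))"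
    unfolding prefixes.simps using inj_on_prefixes[OF L(2), of m] B
    by (subst sum.reindex) (auto simp: case_prod_beta o_def)
  finally show ?case by (simp add: mult.commute)
qed simp

text \<open>The count is read off from total mass 1.\<close>

lemma card_prefixes: "real (card (prefixes B L m)) = real L ^ m"
  using prob_prefixes[of UNIV m] L by (simp add: field_simps)

lemma AE_unit: "AE t in \<nu>. t \<in> {0..1}"
  using supp by (rule AE_prob_1)

lemma AE_prefix: "AE x in \<nu>. \<exists>y\<in>prefixes B L m. real y / real B ^ m \<le> x \<and> x \<le> (real y + 1) / real B ^ m"
proof -
  let ?A = "\<Union>y\<in>prefixes B L m. {real y / real B ^ m..(real y + 1) / real B ^ m}"
  have A: "?A \<in> sets borel" by (intro sets.finite_UN) auto
  have "prob (cyl m y ?A) = 1" if "y \<in> prefixes B L m" for y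
  proof (rule antisym[OF prob_le_1])
    have "{0..1} \<subseteq> cyl m y ?A" using that B by (force simp: divide_right_mono)
    hence "prob {0..1} \<le> prob (cyl m y ?A)"
      by (rule finite_measure_mono) (simp only: sets_eq, rule cyl_borel[OF A])
    thus "1 \<le> prob (cyl m y ?A)" by (simp only: supp)
  qed
  hence "prob ?A = 1" using prob_prefixes[OF A, of m] card_prefixes[of m] L by simp
  hence "AE x in \<nu>. x \<in> ?A" by (rule AE_prob_1)
  thus ?thesis by eventually_elim auto
qed

lemma base_scale:
  assumes "0 < \<delta>" "\<delta> < 1"
  obtains m where "\<delta> \<le> 1 / real B ^ m" "1 / real B ^ Suc m \<le> \<delta>"
proof -
  define k where "k = nat \<lfloor>1 / \<delta>\<rfloor>"
  have k: "real k \<le> 1 / \<delta>" "1 / \<delta> < real k + 1" "1 \<le> k"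
    using assms by (auto simp: k_def le_nat_iff le_floor_iff)
  obtain m where m: "B ^ m \<le> k" "k < B ^ (m + 1)" using ex_power_ivl1[OF B k(3)] by auto
  have "real B ^ m \<le> real k" using m(1) by (metis of_nat_le_iff of_nat_power)
  hence 1: "real B ^ m \<le> 1 / \<delta>" using k(1) by linarith
  have "k + 1 \<le> B ^ Suc m" using m(2) by simp
  hence "real k + 1 \<le> real B ^ Suc m" by (metis of_nat_le_iff of_nat_power of_nat_add of_nat_1)
  hence 2: "1 / \<delta> \<le> real B ^ Suc m" using k(2) by linarith
  show thesis
  proof (rule that)
    have "0 < real B ^ m" "0 < real B ^ Suc m" using B by simp_all
    thus "\<delta> \<le> 1 / real B ^ m" "1 / real B ^ Suc m \<le> \<delta>"
      using 1 2 assms by (simp_all only: pos_le_divide_eq pos_divide_le_eq mult.commute)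
  qed
qed

text \<open>The similarity dimension: the solution s of L * B^(-s) = 1.\<close>

definition sdim :: real where "sdim = ln (real L) / ln (real B)"

lemma sdim_nonneg: "0 \<le> sdim"
  using B L by (auto simp: sdim_def)

lemma base_powr_sdim: "(1 / real B ^ m) powr sdim = 1 / real L ^ m"
proof -
  have "(1 / real B ^ m) powr sdim = exp (- (real m * ln (real B) * sdim))"
    using B by (simp add: powr_def ln_div ln_realpow)
  also have "real m * ln (real B) * sdim = real m * ln (real L)"
    using B by (simp add: sdim_def)
  also have "exp (- (real m * ln (real L))) = 1 / real L ^ m"
    using L by (simp add: exp_minus inverse_eq_divide exp_of_nat_mult)
  finally show ?thesis .
qed

text \<open>At the level m with B^(-m) just above \<delta>, the prefixes whose interval meets the
  given one are integers in a closed range of length 3, hence at most 4, each of weight L^(-m).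
  Replacing L^(-m) by a power of \<delta> moves to level m + 1 and costs the factor L.\<close>

lemma prob_interval_le:
  assumes "0 < \<delta>" "\<delta> < 1"
  shows "prob {x - \<delta>..x + \<delta>} \<le> 4 * real L * \<delta> powr sdim"
proof -
  obtain m where m: "\<delta> \<le> 1 / real B ^ m" "1 / real B ^ Suc m \<le> \<delta>" using base_scale[OF assms] .
  let ?A = "{x - \<delta>..x + \<delta>}" and ?c = "x * real B ^ m"
  let ?Y = "{y \<in> prefixes B L m. ?c - 2 \<le> real y \<and> real y \<le> ?c + 1}"
  have Bm: "0 < real B ^ m" using B by simp
  have zero: "prob (cyl m y ?A) = 0" if "y \<in> prefixes B L m - ?Y" for y
  proof -
    have "AE t in \<nu>. t \<notin> cyl m y ?A"
      using AE_unit
    proof eventually_elim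
      case (elim t)
      show ?case
      proof
        assume "t \<in> cyl m y ?A"
        hence "x - \<delta> \<le> (t + real y) / real B ^ m" "(t + real y) / real B ^ m \<le> x + \<delta>" by auto
        hence "(x - \<delta>) * real B ^ m \<le> t + real y" "t + real y \<le> (x + \<delta>) * real B ^ m"
          using Bm by (simp_all add: field_simps)
        moreover have "\<delta> * real B ^ m \<le> 1" using m(1) Bm by (simp add: field_simps)
        ultimately have "?c - 2 \<le> real y" "real y \<le> ?c + 1" using elim by (auto simp: algebra_simps)
        thus False using that by auto
      qed
    qed
    thus ?thesis using cyl_borel[of ?A m y] by (subst prob_eq_0) auto
  qed
  have "(\<Sum>y\<in>prefixes B L m. prob (cyl m y ?A)) = (\<Sum>y\<in>?Y. prob (cyl m y ?A))"
    using zero by (intro sum.mono_neutral_right) auto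
  also have "\<dots> \<le> (\<Sum>y\<in>?Y. 1)" by (intro sum_mono prob_le_1)
  also have "\<dots> = real (card ?Y)" by simp
  also have "\<dots> \<le> 4"
  proof -
    have "int ` ?Y \<subseteq> {\<lceil>?c - 2\<rceil>..\<lceil>?c - 2\<rceil> + 3}"
    proof
      fix i assume "i \<in> int ` ?Y"
      hence "?c - 2 \<le> real_of_int i" "real_of_int i \<le> ?c + 1" by auto
      thus "i \<in> {\<lceil>?c - 2\<rceil>..\<lceil>?c - 2\<rceil> + 3}" by simp linarith
    qed
    hence "card (int ` ?Y) \<le> card {\<lceil>?c - 2\<rceil>..\<lceil>?c - 2\<rceil> + 3}" by (intro card_mono) auto
    hence "card ?Y \<le> 4" by (simp add: card_image)
    thus ?thesis by simp
  qed
  finally have "(\<Sum>y\<in>prefixes B L m. prob (cyl m y ?A)) / real L ^ m \<le> 4 / real L ^ m"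
    by (rule divide_right_mono) simp
  hence "prob ?A \<le> 4 / real L ^ m"
    by (subst prob_prefixes[where m = m]) simp_all
  also have "\<dots> = 4 * real L * (1 / real L ^ Suc m)" using L by simp
  also have "\<dots> = 4 * real L * (1 / real B ^ Suc m) powr sdim" by (simp only: base_powr_sdim)
  also have "\<dots> \<le> 4 * real L * \<delta> powr sdim"
    using m sdim_nonneg by (intro mult_left_mono powr_mono2) auto
  finally show ?thesis .
qed

text \<open>Almost every x lies in intervals of all levels. The one at level m + 1 has length at
  most \<delta>, so the ball swallows it together with its mass. The quantifier over \<delta> can
  stand under the AE because only countably many levels are involved.\<close>

lemma AE_prob_interval_ge:
  "AE x in \<nu>. \<forall>\<delta>. 0 < \<delta> \<longrightarrow> \<delta> < 1 \<longrightarrow> \<delta> powr sdim / real L \<le> prob {x - \<delta>..x + \<delta>}"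
proof -
  have "AE x in \<nu>. \<forall>m. \<exists>y\<in>prefixes B L m. real y / real B ^ m \<le> x \<and> x \<le> (real y + 1) / real B ^ m"
    by (subst AE_all_countable) (intro allI AE_prefix)
  thus ?thesis
  proof eventually_elim
    case (elim x)
    show ?case
    proof (intro allI impI)
      fix \<delta> :: real assume \<delta>: "0 < \<delta>" "\<delta> < 1"
      obtain m where m: "\<delta> \<le> 1 / real B ^ m" "1 / real B ^ Suc m \<le> \<delta>" using base_scale[OF \<delta>] .
      obtain y where y: "y \<in> prefixes B L (Suc m)" "real y / real B ^ Suc m \<le> x" "x \<le> (real y + 1) / real B ^ Suc m"
        using elim by blast
      let ?A = "{x - \<delta>..x + \<delta>}"
      have "{0..1} \<subseteq> cyl (Suc m) y ?A"
      proof
        fix t :: real assume t: "t \<in> {0..1}"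
        have Bm: "0 < real B ^ Suc m" using B by simp
        have "(t + real y) / real B ^ Suc m \<le> (1 + real y) / real B ^ Suc m"
          "real y / real B ^ Suc m \<le> (t + real y) / real B ^ Suc m"
          using t by (intro divide_right_mono; simp)+
        thus "t \<in> cyl (Suc m) y ?A"
          using y m(2) by (simp only: add_divide_distrib mem_Collect_eq atLeastAtMost_iff) linarith
      qed
      hence "prob {0..1} \<le> prob (cyl (Suc m) y ?A)"
        by (rule finite_measure_mono) (simp only: sets_eq, rule cyl_borel, simp)
      hence "1 \<le> prob (cyl (Suc m) y ?A)" by (simp only: supp)
      also have "\<dots> \<le> (\<Sum>y\<in>prefixes B L (Suc m). prob (cyl (Suc m) y ?A))"
        using y(1) by (intro member_le_sum) auto
      finally have "1 / real L ^ Suc m \<le> (\<Sum>y\<in>prefixes B L (Suc m). prob (cyl (Suc m) y ?A)) / real L ^ Suc m"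
        by (intro divide_right_mono) auto
      also have "\<dots> = prob ?A" by (rule prob_prefixes[symmetric]) simp
      finally have "1 / real L ^ m / real L \<le> prob ?A" by (simp add: mult.commute)
      moreover have "\<delta> powr sdim \<le> 1 / real L ^ m"
        unfolding base_powr_sdim[symmetric] using m \<delta> sdim_nonneg by (intro powr_mono2) auto
      hence "\<delta> powr sdim / real L \<le> 1 / real L ^ m / real L" by (rule divide_right_mono) simp
      ultimately show "\<delta> powr sdim / real L \<le> prob ?A" by linarith
    qed
  qed
qed

end

section \<open>Products of digit measures\<close>

text \<open>Sharing the base makes every product of branches a similarity of ratio 1 / B whatever
  the digit sets are; unequal bases would give affine maps that are not similarities.\<close>

locale product_digit_measure =
  fixes \<nu> :: "'n::finite \<Rightarrow> real measure" and B :: nat and L :: "'n \<Rightarrow> nat"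
  assumes digit_measure: "\<And>i. digit_measure (\<nu> i) B (L i)"
begin

sublocale N: digit_measure "\<nu> i" B "L i" for i
  by (rule digit_measure)

sublocale P: finite_product_prob_space \<nu> UNIV
  by standard simp

definition prod_measure :: "('n \<Rightarrow> real) measure" where
  "prod_measure = PiM UNIV \<nu>"

lemma sets_prod_measure [measurable_cong]: "sets prod_measure = sets (PiM UNIV (\<lambda>_. borel))"
  unfolding prod_measure_def by (intro sets_PiM_cong) (auto simp: N.sets_eq)

lemma space_prod_measure [simp]: "space prod_measure = UNIV"
  by (simp add: prod_measure_def space_PiM)

lemma prob_space_prod_measure: "prob_space prod_measure"
  unfolding prod_measure_def by (rule prob_space_PiM) (rule N.prob_space_axioms)

lemma measurable_vec [measurable]: "(\<lambda>\<omega>. \<chi> i. \<omega> i) \<in> measurable (PiM UNIV (\<lambda>_. borel)) (borel :: (real ^ 'n) measure)"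
proof (subst borel_measurable_euclidean_space, intro ballI)
  fix b :: "real ^ 'n" assume "b \<in> Basis"
  then obtain i where b: "b = axis i 1" by (auto simp: Basis_vec_def)
  show "(\<lambda>\<omega>. (\<chi> i. \<omega> i) \<bullet> b) \<in> borel_measurable (PiM UNIV (\<lambda>_. borel))"
    unfolding b by (simp add: inner_axis)
qed

lemma borel_measurable_nth [measurable]: "(\<lambda>x. x $ i) \<in> borel_measurable (borel :: (real ^ 'n) measure)"
  by (intro borel_measurable_continuous_onI continuous_intros)

definition \<mu> :: "(real ^ 'n) measure" where
  "\<mu> = distr prod_measure borel (\<lambda>\<omega>. \<chi> i. \<omega> i)"

sublocale M: prob_space \<mu>
proof -
  interpret prob_space prod_measure by (rule prob_space_prod_measure)
  show "prob_space \<mu>" unfolding \<mu>_def by (rule prob_space_distr) measurable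
qed

lemma sets_\<mu> [simp, measurable_cong]: "sets \<mu> = sets borel"
  by (simp add: \<mu>_def)

lemma measure_\<mu>: "A \<in> sets borel \<Longrightarrow> measure \<mu> A = measure prod_measure {\<omega>. (\<chi> i. \<omega> i) \<in> A}"
  unfolding \<mu>_def by (subst measure_distr) (auto intro!: arg_cong[where f = "measure prod_measure"])

lemma measure_prod_box:
  assumes "\<And>i. A i \<in> sets borel"
  shows "measure prod_measure {\<omega>. \<forall>i. \<omega> i \<in> A i} = (\<Prod>i\<in>UNIV. measure (\<nu> i) (A i))"
proof -
  have "{\<omega>. \<forall>i. \<omega> i \<in> A i} = Pi\<^sub>E UNIV A" by auto
  thus ?thesis unfolding prod_measure_def
    by (simp only:) (rule P.finite_measure_PiM_emb, simp add: N.sets_eq assms)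
qed

lemma borel_box:
  assumes "\<And>i. A i \<in> sets borel"
  shows "{x :: real ^ 'n. \<forall>i. x $ i \<in> A i} \<in> sets borel"
proof -
  have "{x :: real ^ 'n. \<forall>i. x $ i \<in> A i} = (\<Inter>i. (\<lambda>x. x $ i) -` A i)" by auto
  also have "\<dots> \<in> sets borel"
    using assms by (intro sets.finite_INT measurable_sets_borel[OF borel_measurable_nth]) auto
  finally show ?thesis .
qed

lemma measure_box:
  assumes "\<And>i. A i \<in> sets borel"
  shows "measure \<mu> {x. \<forall>i. x $ i \<in> A i} = (\<Prod>i\<in>UNIV. measure (\<nu> i) (A i))"
  by (subst measure_\<mu>[OF borel_box[OF assms]]) (simp_all add: measure_prod_box assms)

definition digit_vecs :: "('n \<Rightarrow> nat) set" where
  "digit_vecs = PiE UNIV (\<lambda>i. {..<L i})"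

lemma finite_digit_vecs: "finite digit_vecs"
  unfolding digit_vecs_def by (intro finite_PiE) auto

lemma card_digit_vecs: "card digit_vecs = (\<Prod>i\<in>UNIV. L i)"
  unfolding digit_vecs_def by (subst card_PiE) auto

lemma digit_vecs_nonempty: "digit_vecs \<noteq> {}"
  using N.L(1) unfolding digit_vecs_def by (subst PiE_eq_empty_iff) (auto simp: lessThan_empty_iff)

definition push :: "('n \<Rightarrow> nat) \<times> ('n \<Rightarrow> real) \<Rightarrow> 'n \<Rightarrow> real" where
  "push = (\<lambda>(d, \<omega>) i. (\<omega> i + real (d i)) / real B)"

lemma push_measurable [measurable]:
  "push \<in> measurable (measure_pmf (pmf_of_set digit_vecs) \<Otimes>\<^sub>M prod_measure) (PiM UNIV (\<lambda>_. borel))"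
proof -
  have "(\<lambda>z i. (snd z i + real (fst z i)) / real B) \<in>
      measurable (measure_pmf (pmf_of_set digit_vecs) \<Otimes>\<^sub>M prod_measure) (PiM UNIV (\<lambda>_. borel))"
  proof (rule measurable_PiM_single')
    fix i
    have [measurable]: "(\<lambda>d. real (d i)) \<in> borel_measurable (measure_pmf (pmf_of_set digit_vecs))" by simp
    have [measurable]: "(\<lambda>\<omega>. \<omega> i) \<in> borel_measurable prod_measure"
      unfolding measurable_cong_sets[OF sets_prod_measure refl] by measurable
    show "(\<lambda>z. (snd z i + real (fst z i)) / real B) \<in>
        borel_measurable (measure_pmf (pmf_of_set digit_vecs) \<Otimes>\<^sub>M prod_measure)"
      by measurable
  qed (auto simp: space_pair_measure)
  thus ?thesis by (simp add: push_def case_prod_beta')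
qed

text \<open>Choosing a digit vector uniformly means choosing the coordinate digits independently and
  uniformly. On boxes the sum over digit vectors therefore factors into the one-dimensional
  stationarity equations, and boxes determine the product measure.\<close>

lemma prod_measure_self_similar:
  "distr (measure_pmf (pmf_of_set digit_vecs) \<Otimes>\<^sub>M prod_measure) (PiM UNIV (\<lambda>_. borel)) push = prod_measure"
proof -
  let ?D = "distr (measure_pmf (pmf_of_set digit_vecs) \<Otimes>\<^sub>M prod_measure) (PiM UNIV (\<lambda>_. borel)) push"
  interpret R: prob_space prod_measure by (rule prob_space_prod_measure)
  interpret Q: pair_prob_space "measure_pmf (pmf_of_set digit_vecs)" prod_measure ..
  interpret D: prob_space ?D by (rule Q.prob_space_distr) (rule push_measurable)
  have "?D = PiM UNIV \<nu>"
  proof (rule P.PiM_eqI)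
    show "sets ?D = sets (PiM UNIV \<nu>)" using sets_prod_measure by (simp add: prod_measure_def)
    fix A assume "\<And>i. i \<in> UNIV \<Longrightarrow> A i \<in> sets (\<nu> i)"
    hence A: "A i \<in> sets borel" for i by (simp add: N.sets_eq)
    have PA: "Pi\<^sub>E UNIV A \<in> sets (PiM UNIV (\<lambda>_. borel))" using A by (intro sets_PiM_I_finite) auto
    have pre: "{x. (x + real d) / real B \<in> A i} \<in> sets borel" for d i
      using measurable_sets_borel[of "\<lambda>x. (x + real d) / real B" borel "A i"] A by (simp add: vimage_def)
    have "measure ?D (Pi\<^sub>E UNIV A) = (\<Sum>d\<in>digit_vecs. measure prod_measure {\<omega> \<in> space prod_measure. push (d, \<omega>) \<in> Pi\<^sub>E UNIV A}) / card digit_vecs"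
      by (rule measure_distr_pmf_of_set[OF finite_digit_vecs digit_vecs_nonempty prob_space_prod_measure push_measurable PA])
    also have "(\<Sum>d\<in>digit_vecs. measure prod_measure {\<omega> \<in> space prod_measure. push (d, \<omega>) \<in> Pi\<^sub>E UNIV A}) =
        (\<Sum>d\<in>digit_vecs. \<Prod>i\<in>UNIV. measure (\<nu> i) {x. (x + real (d i)) / real B \<in> A i})"
    proof (rule sum.cong[OF refl])
      fix d
      have "{\<omega> \<in> space prod_measure. push (d, \<omega>) \<in> Pi\<^sub>E UNIV A} = {\<omega>. \<forall>i. \<omega> i \<in> {x. (x + real (d i)) / real B \<in> A i}}"
        by (auto simp: push_def)
      thus "measure prod_measure {\<omega> \<in> space prod_measure. push (d, \<omega>) \<in> Pi\<^sub>E UNIV A} =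
          (\<Prod>i\<in>UNIV. measure (\<nu> i) {x. (x + real (d i)) / real B \<in> A i})"
        by (simp only: measure_prod_box[OF pre])
    qed
    also have "\<dots> = (\<Prod>i\<in>UNIV. \<Sum>d<L i. measure (\<nu> i) {x. (x + real d) / real B \<in> A i})"
      unfolding digit_vecs_def by (rule prod_sum_PiE[symmetric]) auto
    also have "\<dots> / card digit_vecs = (\<Prod>i\<in>UNIV. (\<Sum>d<L i. measure (\<nu> i) {x. (x + real d) / real B \<in> A i}) / real (L i))"
      by (simp add: card_digit_vecs prod_dividef)
    also have "\<dots> = (\<Prod>i\<in>UNIV. measure (\<nu> i) (A i))"
      by (intro prod.cong refl N.prob_step[symmetric] A)
    finally show "emeasure ?D (Pi\<^sub>E UNIV A) = (\<Prod>i\<in>UNIV. emeasure (\<nu> i) (A i))"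
      by (simp add: D.emeasure_eq_measure N.emeasure_eq_measure prod_ennreal)
  qed simp
  thus ?thesis by (simp add: prod_measure_def)
qed

lemma stationary:
  assumes "A \<in> sets borel"
  shows "measure \<mu> A = (\<Sum>d\<in>digit_vecs. measure (distr \<mu> borel (\<lambda>x. (1 / real B) *\<^sub>R x + (\<chi> i. real (d i) / real B))) A) / card digit_vecs"
proof -
  let ?E = "{\<omega> :: 'n \<Rightarrow> real. (\<chi> i. \<omega> i) \<in> A}"
  have E: "?E \<in> sets (PiM UNIV (\<lambda>_. borel))"
    using measurable_sets[OF measurable_vec assms] by (simp add: vimage_def space_PiM)
  have "measure \<mu> A = measure prod_measure ?E" by (rule measure_\<mu>[OF assms])
  also have "\<dots> = measure (distr (measure_pmf (pmf_of_set digit_vecs) \<Otimes>\<^sub>M prod_measure) (PiM UNIV (\<lambda>_. borel)) push) ?E"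
    by (simp only: prod_measure_self_similar)
  also have "\<dots> = (\<Sum>d\<in>digit_vecs. measure prod_measure {\<omega> \<in> space prod_measure. push (d, \<omega>) \<in> ?E}) / card digit_vecs"
    by (rule measure_distr_pmf_of_set[OF finite_digit_vecs digit_vecs_nonempty prob_space_prod_measure push_measurable E])
  also have "(\<Sum>d\<in>digit_vecs. measure prod_measure {\<omega> \<in> space prod_measure. push (d, \<omega>) \<in> ?E}) =
     (\<Sum>d\<in>digit_vecs. measure (distr \<mu> borel (\<lambda>x. (1 / real B) *\<^sub>R x + (\<chi> i. real (d i) / real B))) A)"
  proof (rule sum.cong[OF refl])
    fix d
    let ?f = "\<lambda>x :: real ^ 'n. (1 / real B) *\<^sub>R x + (\<chi> i. real (d i) / real B)"
    have f: "?f \<in> borel_measurable borel" by measurable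
    have fA: "?f -` A \<in> sets borel" using measurable_sets_borel[OF f assms] .
    have "measure (distr \<mu> borel ?f) A = measure \<mu> (?f -` A)"
      using f assms by (subst measure_distr) (simp_all add: \<mu>_def)
    also have "\<dots> = measure prod_measure {\<omega>. (\<chi> i. \<omega> i) \<in> ?f -` A}" by (rule measure_\<mu>[OF fA])
    also have "{\<omega>. (\<chi> i. \<omega> i) \<in> ?f -` A} = {\<omega> \<in> space prod_measure. push (d, \<omega>) \<in> ?E}"
    proof -
      have "?f (\<chi> i. \<omega> i) = (\<chi> i. push (d, \<omega>) i)" for \<omega>
        by (simp add: vec_eq_iff push_def add_divide_distrib)
      thus ?thesis by simp
    qed
    finally show "measure prod_measure {\<omega> \<in> space prod_measure. push (d, \<omega>) \<in> ?E} = measure (distr \<mu> borel ?f) A" ..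
  qed
  finally show ?thesis .
qed

lemma self_similar_measure_\<mu>:
  assumes "2 \<le> L i0"
  shows "self_similar_measure \<mu>"
proof -
  obtain h where h: "bij_betw h {0..<card digit_vecs} digit_vecs"
    using ex_bij_betw_nat_finite[OF finite_digit_vecs] by blast
  let ?l = "card digit_vecs"
  have l: "2 \<le> ?l"
  proof -
    have "L i0 \<le> (\<Prod>i\<in>UNIV. L i)"
      using N.L(1) by (subst prod.remove[of _ i0]) (auto simp: Suc_le_eq intro!: prod_pos)
    thus ?thesis using assms by (simp add: card_digit_vecs)
  qed
  have "stationary_measure ?l (\<lambda>_. 1 / real B) (\<lambda>j. \<chi> i. real (h j i) / real B) (\<lambda>_. 1 / real ?l) \<mu>"
    unfolding stationary_measure_def
  proof (intro conjI ballI)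
    fix A :: "(real ^ 'n) set" assume A: "A \<in> sets borel"
    have "measure \<mu> A = (\<Sum>d\<in>digit_vecs. 1 / real ?l * measure (distr \<mu> borel (\<lambda>x. (1 / real B) *\<^sub>R x + (\<chi> i. real (d i) / real B))) A)"
      by (subst stationary[OF A]) (simp add: sum_divide_distrib)
    also have "\<dots> = (\<Sum>j\<in>{0..<?l}. 1 / real ?l * measure (distr \<mu> borel (\<lambda>x. (1 / real B) *\<^sub>R x + (\<chi> i. real (h j i) / real B))) A)"
      by (rule sum.reindex_bij_betw[OF h, symmetric])
    finally show "measure \<mu> A = (\<Sum>j<?l. 1 / real ?l * measure (distr \<mu> borel (\<lambda>x. (1 / real B) *\<^sub>R x + (\<chi> i. real (h j i) / real B))) A)"
      by (simp only: atLeast0LessThan)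
  qed (auto intro: M.prob_space_axioms)
  thus ?thesis
    unfolding self_similar_measure_def using l N.B
    by (intro exI[of _ ?l] exI[of _ "\<lambda>_. 1 / real B"] exI[of _ "\<lambda>j. \<chi> i. real (h j i) / real B"] exI[of _ "\<lambda>_. 1 / real ?l"]) auto
qed

lemma measure_unit_cube: "measure \<mu> (cbox 0 1) = 1"
proof -
  have "cbox 0 1 = {x :: real ^ 'n. \<forall>i. x $ i \<in> {0..1}}" by (auto simp: mem_box_cart)
  thus ?thesis by (simp only:) (subst measure_box, auto simp: N.supp)
qed

lemma AE_nth:
  assumes "AE x in \<nu> i. P x"
  shows "AE x in \<mu>. P (x $ i)"
proof (rule AE_distrD[where f = "\<lambda>x. x $ i" and M' = "\<nu> i" and P = P])
  show f: "(\<lambda>x. x $ i) \<in> measurable \<mu> (\<nu> i)"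
    unfolding measurable_cong_sets[OF sets_\<mu> N.sets_eq] by measurable
  have "distr \<mu> (\<nu> i) (\<lambda>x. x $ i) = distr prod_measure (\<nu> i) (\<lambda>\<omega>. \<omega> i)"
    unfolding \<mu>_def using f
    by (subst distr_distr) (auto simp: o_def N.sets_eq cong: measurable_cong_sets)
  also have "\<dots> = \<nu> i" unfolding prod_measure_def
    by (rule distr_PiM_component) (auto intro: N.prob_space_axioms)
  finally show "AE x in distr \<mu> (\<nu> i) (\<lambda>x. x $ i). P x" using assms by (simp only:)
qed

end

section \<open>Dimension and counting property of the product\<close>

lemma tendsto_ln_ratio:
  fixes f :: "real \<Rightarrow> real"
  assumes c: "0 < a" "0 < b"
    and f: "\<And>\<delta>. 0 < \<delta> \<Longrightarrow> \<delta> < 1 \<Longrightarrow> a * \<delta> powr s \<le> f \<delta> \<and> f \<delta> \<le> b * \<delta> powr s"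
  shows "((\<lambda>\<delta>. ln (f \<delta>) / ln \<delta>) \<longlongrightarrow> s) (at_right 0)"
proof -
  have lim: "((\<lambda>\<delta>. c / ln \<delta> + s) \<longlongrightarrow> s) (at_right 0)" for c :: real
  proof -
    have "((\<lambda>\<delta>. c / ln \<delta>) \<longlongrightarrow> 0) (at_right 0)"
      by (rule tendsto_divide_0[OF tendsto_const filterlim_at_bot_imp_at_infinity[OF ln_at_0]])
    from tendsto_add[OF this tendsto_const[of s]] show ?thesis by simp
  qed
  have ev: "eventually (\<lambda>\<delta>. \<delta> \<in> {0<..<1}) (at_right (0 :: real))"
    by (rule eventually_at_right_real) simp
  \<comment> \<open>Dividing by the negative number ln \<delta> swaps the two bounds, so b governs
    the lower one.\<close>
  have bd: "ln b / ln \<delta> + s \<le> ln (f \<delta>) / ln \<delta> \<and> ln (f \<delta>) / ln \<delta> \<le> ln a / ln \<delta> + s" if "\<delta> \<in> {0<..<1}" for \<delta>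
  proof -
    have d: "0 < \<delta>" "\<delta> < 1" "ln \<delta> < 0" using that by auto
    have f': "a * \<delta> powr s \<le> f \<delta>" "f \<delta> \<le> b * \<delta> powr s" using f[OF d(1,2)] by auto
    have "0 < a * \<delta> powr s" using c d by simp
    hence f0: "0 < f \<delta>" using f' by linarith
    have e: "ln (c * \<delta> powr s) / ln \<delta> = ln c / ln \<delta> + s" if "0 < c" for c
      using that d by (simp add: ln_mult ln_powr add_divide_distrib)
    have "ln (a * \<delta> powr s) \<le> ln (f \<delta>)" "ln (f \<delta>) \<le> ln (b * \<delta> powr s)"
      using f' f0 c d by simp_all
    thus ?thesis
      unfolding e[OF c(1), symmetric] e[OF c(2), symmetric] using d(3)
      by (intro conjI divide_right_mono_neg) auto
  qed
  show ?thesis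
    by (rule tendsto_sandwich[OF _ _ lim[of "ln b"] lim[of "ln a"]])
       (use ev bd in \<open>auto elim!: eventually_mono\<close>)
qed

lemma dim_H_eqI:
  assumes "prob_space \<mu>" "has_dim_H \<mu> d"
  shows "dim_H \<mu> = d"
  unfolding dim_H_def
proof (rule the_equality)
  interpret prob_space \<mu> by fact
  fix d' assume d': "has_dim_H \<mu> d'"
  have "AE x in \<mu>. d' = d"
    using d'[unfolded has_dim_H_def] assms(2)[unfolded has_dim_H_def]
  proof eventually_elim
    case (elim x)
    thus ?case by (intro tendsto_unique[of "at_right (0 :: real)"]) auto
  qed
  thus "d' = d" by simp
qed fact

text \<open>Doubling the radius makes the inequality strict, so a lattice point realising it exists
  by the definition of the infimum alone.\<close>

lemma approx_set_subset:
  assumes "0 < \<delta>"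
  shows "approx_set \<delta> q \<gamma> \<subseteq> {x. \<forall>i. x $ i \<in> near_set (2 * \<delta>) q (\<gamma> $ i)}"
proof (intro subsetI CollectI allI)
  fix x i assume x: "x \<in> approx_set \<delta> q \<gamma>"
  have ne: "int_lattice \<noteq> {}" by (auto simp: int_lattice_def intro!: exI[of _ 0])
  have "infdist (real q *\<^sub>R x - \<gamma>) int_lattice < 2 * \<delta>" using x assms by (simp add: approx_set_def)
  then obtain z where z: "z \<in> int_lattice" "dist (real q *\<^sub>R x - \<gamma>) z < 2 * \<delta>"
    unfolding infdist_notempty[OF ne] by (subst (asm) cINF_less_iff[OF ne]) (auto intro!: bdd_belowI[of _ 0])
  obtain k :: int where k: "z $ i = of_int k" using z(1) by (auto simp: int_lattice_def elim!: Ints_cases)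
  have "\<bar>(real q *\<^sub>R x - \<gamma> - z) $ i\<bar> \<le> norm (real q *\<^sub>R x - \<gamma> - z)" by (rule component_le_norm_cart)
  also have "\<dots> < 2 * \<delta>" using z(2) by (simp add: dist_norm)
  finally show "x $ i \<in> near_set (2 * \<delta>) q (\<gamma> $ i)"
    unfolding near_set_def using k by (intro CollectI exI[of _ k]) simp
qed

text \<open>The Euclidean norm is at most the sum of the absolute coordinates, hence the division by
  the dimension.\<close>

lemma approx_set_superset:
  fixes \<gamma> :: "real ^ 'n"
  shows "{x. \<forall>i. x $ i \<in> near_set (\<delta> / real CARD('n)) q (\<gamma> $ i)} \<subseteq> approx_set \<delta> q \<gamma>"
proof
  fix x :: "real ^ 'n" assume "x \<in> {x. \<forall>i. x $ i \<in> near_set (\<delta> / real CARD('n)) q (\<gamma> $ i)}"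
  hence "\<forall>i. \<exists>z::int. \<bar>real q * x $ i - \<gamma> $ i - of_int z\<bar> \<le> \<delta> / real CARD('n)"
    by (auto simp: near_set_def)
  then obtain z :: "'n \<Rightarrow> int" where z: "\<And>i. \<bar>real q * x $ i - \<gamma> $ i - of_int (z i)\<bar> \<le> \<delta> / real CARD('n)" by metis
  define w :: "real ^ 'n" where "w = (\<chi> i. of_int (z i))"
  have "infdist (real q *\<^sub>R x - \<gamma>) int_lattice \<le> dist (real q *\<^sub>R x - \<gamma>) w"
    by (rule infdist_le) (simp add: w_def int_lattice_def)
  also have "\<dots> \<le> (\<Sum>i\<in>UNIV. \<bar>(real q *\<^sub>R x - \<gamma> - w) $ i\<bar>)"
    unfolding dist_norm by (rule norm_le_l1_cart)
  also have "\<dots> \<le> (\<Sum>i\<in>(UNIV :: 'n set). \<delta> / real CARD('n))"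
    using z by (intro sum_mono) (simp add: w_def)
  also have "\<dots> = \<delta>" by simp
  finally show "x \<in> approx_set \<delta> q \<gamma>" by (simp add: approx_set_def)
qed

lemma approx_set_borel: "approx_set \<delta> q \<gamma> \<in> sets borel"
  unfolding approx_set_def
  by (intro borel_closed closed_Collect_le continuous_on_infdist continuous_intros)

text \<open>A K of order 1 / \<delta> that is admissible in \<open>prob_near_set_le\<close>. The
  range reaches up to 2 because the radius is doubled in \<open>approx_set_subset\<close>.\<close>

lemma upper_frequency:
  assumes "0 < \<delta>" "\<delta> < 2"
  obtains K where "0 < K" "K = 1 \<or> 6 * real K * \<delta> \<le> 1" "1 / real K \<le> 12 * \<delta>" "real K \<le> 2 / \<delta>"
proof (cases "6 * \<delta> \<le> 1")
  case True
  define K where "K = nat \<lfloor>1 / (6 * \<delta>)\<rfloor>"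
  have 1: "1 \<le> 1 / (6 * \<delta>)" using True assms by simp
  hence "1 \<le> \<lfloor>1 / (6 * \<delta>)\<rfloor>" by (simp only: one_le_floor)
  moreover from this have "int K = \<lfloor>1 / (6 * \<delta>)\<rfloor>" unfolding K_def by linarith
  ultimately have K: "1 \<le> K" "real K \<le> 1 / (6 * \<delta>)" "1 / (6 * \<delta>) < real K + 1"
    by linarith+
  have "1 / (6 * \<delta>) < 2 * real K" using K by simp
  hence "1 < 2 * real K * (6 * \<delta>)" using assms by (simp add: field_simps)
  hence "1 / real K \<le> 12 * \<delta>" using K by (simp add: field_simps)
  moreover have "6 * real K * \<delta> \<le> 1" using K(2) assms by (simp add: field_simps)
  moreover have "1 / (6 * \<delta>) \<le> 2 / \<delta>" using assms by (simp add: field_simps)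
  ultimately show thesis using K by (intro that[of K]) auto
next
  case False
  show thesis by (rule that[of 1]) (use False assms in auto)
qed

lemma lower_frequency:
  assumes "0 < \<rho>" "\<rho> < 1"
  obtains K where "0 < K" "2 \<le> real K * \<rho>" "real K * \<rho> \<le> 3"
proof
  define K where "K = nat \<lceil>2 / \<rho>\<rceil>"
  have "0 < 2 / \<rho>" using assms by simp
  hence K: "2 / \<rho> \<le> real K" "real K < 2 / \<rho> + 1" by (auto simp: K_def) linarith+
  show "2 \<le> real K * \<rho>" using K(1) assms by (simp add: field_simps)
  thus "0 < K" by (auto intro!: gr0I)
  have "real K * \<rho> \<le> (2 / \<rho> + 1) * \<rho>" using K assms by (intro mult_right_mono) auto
  also have "\<dots> = 2 + \<rho>" using assms by (simp add: field_simps)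
  finally show "real K * \<rho> \<le> 3" using assms by simp
qed

section \<open>Dimension and counting property\<close>

context product_digit_measure
begin

text \<open>The ball lies between cubes of half-side \<delta> / n and \<delta>. Cubes have product
  measure, so the power bounds of the coordinates multiply and the exponents add.\<close>

lemma has_dim_H_\<mu>: "has_dim_H \<mu> (\<Sum>i\<in>UNIV. N.sdim i)"
proof -
  let ?n = "real CARD('n)" and ?s = "\<Sum>i\<in>UNIV. N.sdim i"
  let ?c1 = "\<Prod>i\<in>UNIV. (1 / ?n) powr N.sdim i / real (L i)" and ?c2 = "\<Prod>i\<in>UNIV. 4 * real (L i)"
  have "AE x in \<mu>. \<forall>i. \<forall>\<delta>. 0 < \<delta> \<longrightarrow> \<delta> < 1 \<longrightarrow>
      \<delta> powr N.sdim i / real (L i) \<le> measure (\<nu> i) {x $ i - \<delta>..x $ i + \<delta>}"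
    using AE_nth[OF N.AE_prob_interval_ge] by (simp add: AE_all_countable)
  thus ?thesis
    unfolding has_dim_H_def
  proof eventually_elim
    case (elim x)
    show ?case
    proof (rule tendsto_ln_ratio[where a = ?c1 and b = ?c2])
      show "0 < ?c1" "0 < ?c2" using N.L by (auto intro!: prod_pos)
      fix \<delta> :: real assume \<delta>: "0 < \<delta>" "\<delta> < 1"
      have box: "{y :: real ^ 'n. \<forall>i. y $ i \<in> {x $ i - r..x $ i + r}} \<in> sets borel" for r
        by (rule borel_box) simp
      show "?c1 * \<delta> powr ?s \<le> measure \<mu> (cball x \<delta>) \<and> measure \<mu> (cball x \<delta>) \<le> ?c2 * \<delta> powr ?s"
      proof
        have "?c1 * \<delta> powr ?s = (\<Prod>i\<in>UNIV. (1 / ?n) powr N.sdim i / real (L i) * \<delta> powr N.sdim i)"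
          using \<delta> by (simp add: powr_sum flip: prod.distrib)
        also have "\<dots> \<le> (\<Prod>i\<in>UNIV. measure (\<nu> i) {x $ i - \<delta> / ?n..x $ i + \<delta> / ?n})"
        proof (intro prod_mono conjI)
          fix i
          have "\<delta> / ?n \<le> \<delta> / 1" using \<delta> by (intro divide_left_mono) (auto simp: Suc_le_eq)
          hence "\<delta> / ?n < 1" using \<delta> by linarith
          moreover have "0 < \<delta> / ?n" using \<delta> by simp
          ultimately have "(\<delta> / ?n) powr N.sdim i / real (L i) \<le> measure (\<nu> i) {x $ i - \<delta> / ?n..x $ i + \<delta> / ?n}"
            using elim by blast
          moreover have "(1 / ?n) powr N.sdim i / real (L i) * \<delta> powr N.sdim i = (\<delta> / ?n) powr N.sdim i / real (L i)"
            using \<delta> by (simp add: powr_divide)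
          ultimately show "(1 / ?n) powr N.sdim i / real (L i) * \<delta> powr N.sdim i \<le> measure (\<nu> i) {x $ i - \<delta> / ?n..x $ i + \<delta> / ?n}"
            by (simp only:)
        qed simp
        also have "\<dots> = measure \<mu> {y. \<forall>i. y $ i \<in> {x $ i - \<delta> / ?n..x $ i + \<delta> / ?n}}"
          by (rule measure_box[symmetric]) simp
        also have "\<dots> \<le> measure \<mu> (cball x \<delta>)"
        proof (rule M.finite_measure_mono)
          show "{y. \<forall>i. y $ i \<in> {x $ i - \<delta> / ?n..x $ i + \<delta> / ?n}} \<subseteq> cball x \<delta>"
          proof
            fix y assume y: "y \<in> {y. \<forall>i. y $ i \<in> {x $ i - \<delta> / ?n..x $ i + \<delta> / ?n}}"
            have "norm (x - y) \<le> (\<Sum>i\<in>UNIV. \<bar>(x - y) $ i\<bar>)" by (rule norm_le_l1_cart)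
            also have "\<dots> \<le> (\<Sum>i\<in>(UNIV :: 'n set). \<delta> / ?n)"
            proof (rule sum_mono)
              fix i show "\<bar>(x - y) $ i\<bar> \<le> \<delta> / ?n" using y[simplified, rule_format, of i] by (simp add: abs_le_iff)
            qed
            also have "\<dots> = \<delta>" by simp
            finally show "y \<in> cball x \<delta>" by (simp add: dist_norm)
          qed
        qed simp
        finally show "?c1 * \<delta> powr ?s \<le> measure \<mu> (cball x \<delta>)" .
      next
        have "measure \<mu> (cball x \<delta>) \<le> measure \<mu> {y. \<forall>i. y $ i \<in> {x $ i - \<delta>..x $ i + \<delta>}}"
        proof (rule M.finite_measure_mono)
          show "cball x \<delta> \<subseteq> {y. \<forall>i. y $ i \<in> {x $ i - \<delta>..x $ i + \<delta>}}"
          proof (intro subsetI CollectI allI)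
            fix y i assume "y \<in> cball x \<delta>"
            hence "\<bar>(x - y) $ i\<bar> \<le> \<delta>" using component_le_norm_cart[of "x - y" i] by (simp add: dist_norm)
            thus "y $ i \<in> {x $ i - \<delta>..x $ i + \<delta>}" by (simp add: abs_le_iff)
          qed
        qed (use box in simp)
        also have "\<dots> = (\<Prod>i\<in>UNIV. measure (\<nu> i) {x $ i - \<delta>..x $ i + \<delta>})"
          by (rule measure_box) simp
        also have "\<dots> \<le> (\<Prod>i\<in>UNIV. 4 * real (L i) * \<delta> powr N.sdim i)"
          using \<delta> by (intro prod_mono conjI N.prob_interval_le) auto
        also have "\<dots> = ?c2 * \<delta> powr ?s"
          using \<delta> by (simp add: powr_sum prod.distrib)
        finally show "measure \<mu> (cball x \<delta>) \<le> ?c2 * \<delta> powr ?s" .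
      qed
    qed
  qed
qed

text \<open>At each q all factors except the one for \<open>i0\<close> are free of error, so the
  product is linear in the single error \<open>F i0 q\<close>, and its average over q is all that
  matters. The condition on H covers both cutoffs, K - 1 above and 2 K below; the latter is at most
  6 n / \<delta>.\<close>

lemma sum_approx_set_bounds:
  assumes L: "\<And>i. i \<noteq> i0 \<Longrightarrow> L i = B" and "0 < Q" and \<delta>: "0 < \<delta>" "\<delta> < 1"
    and H: "6 * real CARD('n) / \<delta> < real H + 1" and small: "fourier_sum (\<nu> i0) Q H \<le> real Q / 100"
  shows "(\<Sum>q=Q..2*Q. measure \<mu> (approx_set \<delta> q \<gamma>)) \<le> 3 * 96 ^ CARD('n) * real Q * \<delta> ^ CARD('n)"
    and "real Q * \<delta> ^ CARD('n) / (2 * (15 * real CARD('n)) ^ CARD('n)) \<le> (\<Sum>q=Q..2*Q. measure \<mu> (approx_set \<delta> q \<gamma>))"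
proof -
  let ?n = "CARD('n)"
  define F where "F i q = (\<Sum>h=1..H. norm (fourier (\<nu> i) (real (q * h))))" for i q
  have F0: "0 \<le> F i q" for i q unfolding F_def by (intro sum_nonneg) auto
  have Fz: "F i q = 0" if "i \<noteq> i0" "0 < q" for i q
    unfolding F_def using that L by (intro sum.neutral ballI) (subst N.fourier_nat_eq_0, auto)
  have Fs: "(\<Sum>q=Q..2*Q. F i0 q) \<le> real Q / 100" using small by (simp add: F_def fourier_sum_def)
  have n1: "1 \<le> real ?n" by (simp add: Suc_le_eq)
  show "(\<Sum>q=Q..2*Q. measure \<mu> (approx_set \<delta> q \<gamma>)) \<le> 3 * 96 ^ ?n * real Q * \<delta> ^ ?n"
  proof -
    obtain K where K: "0 < K" "K = 1 \<or> 6 * real K * (2 * \<delta>) \<le> 1" "1 / real K \<le> 12 * (2 * \<delta>)" "real K \<le> 2 / (2 * \<delta>)"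
      using upper_frequency[of "2 * \<delta>"] \<delta> by auto
    have "real K \<le> 1 / \<delta>" using K by simp
    also have "\<dots> \<le> 6 * real ?n / \<delta>"
    proof (rule divide_right_mono)
      show "1 \<le> 6 * real ?n" using n1 by linarith
    qed (use \<delta> in simp)
    also have "\<dots> < real H + 1" by (rule H)
    finally have KH: "K \<le> H + 1" by linarith
    have each: "measure \<mu> (approx_set \<delta> q \<gamma>) \<le> (96 * \<delta>) ^ ?n * (1 + 2 * F i0 q)" if q: "q \<in> {Q..2*Q}" for q
    proof -
      have q0: "0 < q" using q \<open>0 < Q\<close> by auto
      have "measure \<mu> (approx_set \<delta> q \<gamma>) \<le> measure \<mu> {x. \<forall>i. x $ i \<in> near_set (2 * \<delta>) q (\<gamma> $ i)}"
        using approx_set_subset[OF \<delta>(1)] borel_box[of "\<lambda>i. near_set (2 * \<delta>) q (\<gamma> $ i)"]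
        by (intro M.finite_measure_mono) auto
      also have "\<dots> = (\<Prod>i\<in>UNIV. measure (\<nu> i) (near_set (2 * \<delta>) q (\<gamma> $ i)))"
        by (rule measure_box) simp
      also have "\<dots> \<le> (\<Prod>i\<in>UNIV. 96 * \<delta> * (1 + 2 * F i q))"
      proof (intro prod_mono conjI)
        fix i
        have "measure (\<nu> i) (near_set (2 * \<delta>) q (\<gamma> $ i)) \<le>
            4 / real K * (1 + 2 * (\<Sum>h=1..<K. norm (fourier (\<nu> i) (real (q * h)))))"
          using K by (intro N.prob_near_set_le) auto
        also have "\<dots> \<le> 96 * \<delta> * (1 + 2 * F i q)"
        proof (intro mult_mono add_left_mono)
          \<comment> \<open>Here 96 = 4 * 12 * 2, the last factor coming from the doubled
            radius.\<close>
          show "4 / real K \<le> 96 * \<delta>" using K(3) by simp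
          show "(\<Sum>h=1..<K. norm (fourier (\<nu> i) (real (q * h)))) \<le> F i q"
            unfolding F_def using KH by (intro sum_mono2) auto
        qed (use \<delta> in \<open>auto intro!: add_nonneg_nonneg sum_nonneg\<close>)
        finally show "measure (\<nu> i) (near_set (2 * \<delta>) q (\<gamma> $ i)) \<le> 96 * \<delta> * (1 + 2 * F i q)" .
      qed simp
      also have "\<dots> = (96 * \<delta>) ^ ?n * (\<Prod>i\<in>UNIV. 1 + 2 * F i q)"
        by (simp only: prod.distrib prod_constant power_mult_distrib)
      also have "(\<Prod>i\<in>UNIV. 1 + 2 * F i q) = 1 + 2 * F i0 q"
        using Fz q0 by (subst prod.remove[of _ i0]) (auto intro!: prod.neutral)
      finally show ?thesis .
    qed
    have "(\<Sum>q=Q..2*Q. measure \<mu> (approx_set \<delta> q \<gamma>)) \<le> (\<Sum>q=Q..2*Q. (96 * \<delta>) ^ ?n * (1 + 2 * F i0 q))"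
      by (intro sum_mono each)
    also have "\<dots> = (96 * \<delta>) ^ ?n * (real Q + 1 + 2 * (\<Sum>q=Q..2*Q. F i0 q))"
      by (simp add: sum_distrib_left[symmetric] sum.distrib)
    \<comment> \<open>The window has Q + 1 integers and the errors add at most Q / 50.\<close>
    also have "\<dots> \<le> (96 * \<delta>) ^ ?n * (3 * real Q)"
      using Fs \<open>0 < Q\<close> \<delta> by (intro mult_left_mono) auto
    finally show ?thesis by (simp add: power_mult_distrib mult_ac)
  qed
  show "real Q * \<delta> ^ ?n / (2 * (15 * real ?n) ^ ?n) \<le> (\<Sum>q=Q..2*Q. measure \<mu> (approx_set \<delta> q \<gamma>))"
  proof -
    define \<rho> where "\<rho> = \<delta> / real ?n"
    have "\<delta> / real ?n \<le> \<delta> / 1" using \<delta> by (intro divide_left_mono) (auto simp: Suc_le_eq)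
    hence "\<rho> < 1" unfolding \<rho>_def using \<delta> by linarith
    moreover have "0 < \<rho>" unfolding \<rho>_def using \<delta> by simp
    ultimately have \<rho>: "0 < \<rho>" "\<rho> < 1" by simp_all
    obtain K where K: "0 < K" "2 \<le> real K * \<rho>" "real K * \<rho> \<le> 3" using lower_frequency[OF \<rho>] .
    have "real K \<le> 3 / \<rho>" using K(3) \<rho> by (simp add: field_simps)
    hence "real (2 * K) \<le> 6 * real ?n / \<delta>" by (simp add: \<rho>_def)
    also have "\<dots> < real H + 1" by (rule H)
    finally have KH: "2 * K \<le> H" by linarith
    \<comment> \<open>This is the value of the lower bound in \<open>prob_near_set_ge\<close>
      without error. Since K \<rho> is at most 3, it is at least \<rho> / 15.\<close>
    define c where "c = 1 / (5 * real K)"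
    have c0: "0 < c" using K by (simp add: c_def)
    have lower: "c * (1 - 30 * F i q) \<le> measure (\<nu> i) (near_set \<rho> q (\<gamma> $ i))" for i q
    proof -
      have "(\<Sum>h=1..2*K. norm (fourier (\<nu> i) (real (q * h)))) \<le> F i q"
        unfolding F_def using KH by (intro sum_mono2) auto
      hence "(1 / 5 - 6 * F i q) / real K \<le> (1 / 5 - 6 * (\<Sum>h=1..2*K. norm (fourier (\<nu> i) (real (q * h))))) / real K"
        by (intro divide_right_mono) auto
      also have "\<dots> \<le> measure (\<nu> i) (near_set \<rho> q (\<gamma> $ i))"
        using K \<rho> by (intro N.prob_near_set_ge) auto
      finally show ?thesis using K by (simp add: c_def field_simps)
    qed
    have each: "c ^ ?n * (1 - 30 * F i0 q) \<le> measure \<mu> (approx_set \<delta> q \<gamma>)" if q: "q \<in> {Q..2*Q}" for q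
    proof -
      have q0: "0 < q" using q \<open>0 < Q\<close> by auto
      \<comment> \<open>The factor for \<open>i0\<close> is treated apart: 1 - 30
        \<open>F i0 q\<close> may be negative for some q, so monotonicity of products applies only
        to the other coordinates.\<close>
      have "c ^ ?n * (1 - 30 * F i0 q) = c * (1 - 30 * F i0 q) * (\<Prod>i\<in>UNIV - {i0}. c)"
        by (simp add: power_eq_if card_Diff_singleton)
      also have "\<dots> \<le> measure (\<nu> i0) (near_set \<rho> q (\<gamma> $ i0)) * (\<Prod>i\<in>UNIV - {i0}. c)"
        using c0 by (intro mult_right_mono lower prod_nonneg) auto
      also have "\<dots> \<le> measure (\<nu> i0) (near_set \<rho> q (\<gamma> $ i0)) * (\<Prod>i\<in>UNIV - {i0}. measure (\<nu> i) (near_set \<rho> q (\<gamma> $ i)))"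
      proof (intro mult_left_mono prod_mono conjI)
        fix i assume "i \<in> UNIV - {i0}"
        thus "c \<le> measure (\<nu> i) (near_set \<rho> q (\<gamma> $ i))" using lower[of i q] Fz[of i q] q0 by simp
      qed (use c0 in auto)
      also have "\<dots> = (\<Prod>i\<in>UNIV. measure (\<nu> i) (near_set \<rho> q (\<gamma> $ i)))"
        by (rule prod.remove[symmetric]) auto
      also have "\<dots> = measure \<mu> {x. \<forall>i. x $ i \<in> near_set \<rho> q (\<gamma> $ i)}"
        by (rule measure_box[symmetric]) simp
      also have "\<dots> \<le> measure \<mu> (approx_set \<delta> q \<gamma>)"
        using approx_set_superset[of \<delta> q \<gamma>] by (intro M.finite_measure_mono) (auto simp: \<rho>_def approx_set_borel)
      finally show ?thesis .
    qed
    have "real Q * \<delta> ^ ?n / (2 * (15 * real ?n) ^ ?n) = (\<rho> / 15) ^ ?n * (real Q / 2)"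
      by (simp add: \<rho>_def power_divide power_mult_distrib mult_ac)
    also have "\<dots> \<le> c ^ ?n * (real Q / 2)"
    proof (intro mult_right_mono power_mono)
      show "\<rho> / 15 \<le> c" using K by (simp add: c_def field_simps)
    qed (use \<rho> in auto)
    also have "\<dots> \<le> c ^ ?n * (real Q + 1 - 30 * (\<Sum>q=Q..2*Q. F i0 q))"
      using Fs c0 by (intro mult_left_mono) auto
    also have "\<dots> = (\<Sum>q=Q..2*Q. c ^ ?n * (1 - 30 * F i0 q))"
      by (simp add: sum_distrib_left[symmetric] sum_subtractf)
    also have "\<dots> \<le> (\<Sum>q=Q..2*Q. measure \<mu> (approx_set \<delta> q \<gamma>))"
      by (intro sum_mono each)
    finally show ?thesis .
  qed
qed

text \<open>The exponent 5/4 exceeds 1 and hence 1 / n for every n. The constant 6 n in the lower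
  limit for \<delta> is chosen so that the cutoff H stays below Q^(5/4), as
  \<open>fourier_sum_small\<close> demands.\<close>

lemma GCP_\<mu>:
  assumes L: "\<And>i. i \<noteq> i0 \<Longrightarrow> L i = B"
    and S: "\<And>\<theta>. 0 \<le> \<theta> \<Longrightarrow> \<theta> < 1 / real B \<Longrightarrow> (\<Sum>d<B. norm (digit_char (L i0) (\<theta> + real d / real B))) \<le> S"
    and "0 < S" "S \<le> real B powr (1 / 16)"
  shows "GCP \<mu>"
proof -
  let ?n = "CARD('n)"
  have n1: "1 \<le> real ?n" by (simp add: Suc_le_eq)
  obtain M where M: "0 < M" "\<And>Q H. M \<le> real Q \<Longrightarrow> real H \<le> real Q powr (5 / 4) \<Longrightarrow> fourier_sum (\<nu> i0) Q H \<le> real Q / 100"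
    using N.fourier_sum_small[OF S assms(3,4)] by blast
  \<comment> \<open>A sum of the constants of the two bounds dominates both.\<close>
  define C2 where "C2 = 3 * 96 ^ ?n + 2 * (15 * real ?n) ^ ?n"
  have C2: "0 < C2" "3 * 96 ^ ?n \<le> C2" "2 * (15 * real ?n) ^ ?n \<le> C2" "0 < 2 * (15 * real ?n) ^ ?n"
    using n1 by (auto simp: C2_def intro!: add_pos_nonneg)
  have bounds: "inverse C2 * real Q * \<delta> ^ ?n \<le> (\<Sum>q=Q..2*Q. measure \<mu> (approx_set \<delta> q \<gamma>)) \<and>
      (\<Sum>q=Q..2*Q. measure \<mu> (approx_set \<delta> q \<gamma>)) \<le> C2 * real Q * \<delta> ^ ?n"
    if Q: "M \<le> real Q" and \<delta>: "6 * real ?n * real Q powr (- (5 / 4)) \<le> \<delta>" "\<delta> < 1" for \<gamma> Q \<delta>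
  proof -
    have Q0: "0 < Q" using Q M by (auto intro!: gr0I)
    have "0 < 6 * real ?n * real Q powr (- (5 / 4))" using n1 Q0 by (intro mult_pos_pos) auto
    hence \<delta>0: "0 < \<delta>" using \<delta> by linarith
    define H where "H = nat \<lfloor>6 * real ?n / \<delta>\<rfloor>"
    have H1: "6 * real ?n / \<delta> < real H + 1" unfolding H_def using \<delta>0 n1 by linarith
    have "0 \<le> 6 * real ?n / \<delta>" using \<delta>0 by simp
    hence "real H \<le> 6 * real ?n / \<delta>" unfolding H_def by linarith
    also have "\<dots> \<le> real Q powr (5 / 4)"
      using \<delta>(1) \<delta>0 Q0 by (simp add: powr_minus field_simps)
    finally have H2: "fourier_sum (\<nu> i0) Q H \<le> real Q / 100" using Q by (intro M(2))
    note * = sum_approx_set_bounds[OF L Q0 \<delta>0 \<delta>(2) H1 H2, of \<gamma>]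
    have "inverse C2 * real Q * \<delta> ^ ?n = real Q * \<delta> ^ ?n / C2" by (simp add: field_simps)
    also have "\<dots> \<le> real Q * \<delta> ^ ?n / (2 * (15 * real ?n) ^ ?n)"
      using \<delta>0 by (intro divide_left_mono[OF C2(3) _ mult_pos_pos[OF C2(1) C2(4)]]) auto
    also note *(2)
    finally have "inverse C2 * real Q * \<delta> ^ ?n \<le> (\<Sum>q=Q..2*Q. measure \<mu> (approx_set \<delta> q \<gamma>))" .
    moreover have "(\<Sum>q=Q..2*Q. measure \<mu> (approx_set \<delta> q \<gamma>)) \<le> 3 * 96 ^ ?n * real Q * \<delta> ^ ?n"
      by (rule *(1))
    moreover have "3 * 96 ^ ?n * real Q * \<delta> ^ ?n \<le> C2 * real Q * \<delta> ^ ?n"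
      using C2 \<delta>0 by (intro mult_right_mono) auto
    ultimately show ?thesis by linarith
  qed
  have "1 / real ?n < 5 / 4" using n1 by (subst pos_divide_less_eq) linarith+
  moreover have "0 < 6 * real ?n" using n1 by linarith
  ultimately show ?thesis
    unfolding GCP_def using bounds C2(1) M(1) by blast
qed

end

theorem theorem1p9:
  "\<exists>\<mu> :: (real ^ 'n) measure.
     self_similar_measure \<mu> \<and> measure \<mu> (cbox 0 1) = 1 \<and>
     GCP \<mu> \<and> exact_dimensional \<mu> \<and> dim_H \<mu> < real CARD('n)"
proof -
  \<comment> \<open>The exponent \<open>k = 160\<close> makes the logarithmic loss \<open>4 k + 6\<close> smaller than \<open>B powr (1 / 16) = 2 ^ (k / 16)\<close>.\<close>
  define B :: nat where "B = 2 ^ 160"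
  \<comment> \<open>Any coordinate can be the thin one; \<open>undefined\<close> just picks
    one.\<close>
  define i0 :: 'n where "i0 = undefined"
  define L where "L i = (if i = i0 then 2 ^ 159 else B)" for i :: 'n
  have B: "2 \<le> B" unfolding B_def by simp
  have L: "0 < L i" "L i \<le> B" "2 \<le> L i" for i using B by (auto simp: L_def B_def)
  have "\<exists>\<nu>. digit_measure \<nu> B (L i)" for i
    using digit_measure_exists[OF B L(1,2)] B L unfolding digit_measure_def digit_measure_axioms_def by blast
  then obtain \<nu> where \<nu>: "\<And>i. digit_measure (\<nu> i) B (L i)" by metis
  interpret product_digit_measure \<nu> B L by (rule product_digit_measure.intro) (rule \<nu>)
  have S: "(\<Sum>d<B. norm (digit_char (L i0) (\<theta> + real d / real B))) \<le> 1024" if "0 \<le> \<theta>" "\<theta> < 1 / real B" for \<theta>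
  proof -
    have "(\<Sum>d<B. norm (digit_char (L i0) (\<theta> + real d / real B))) \<le> 2 + 2 * real B / real (L i0) * harm B"
      using that by (intro sum_digit_char_le B L)
    also have "2 * real B / real (L i0) = 4" by (simp add: B_def L_def)
    also have "harm B \<le> (real 160 + 1 :: real)" unfolding B_def by (rule harm_power_two_le)
    finally show ?thesis by simp
  qed
  have "real B powr (1 / 16) = 1024"
  proof -
    have "real B = 1024 powr real 16" by (subst powr_realpow) (simp_all add: B_def)
    thus ?thesis by (simp add: powr_powr)
  qed
  hence "GCP \<mu>" by (intro GCP_\<mu>[of i0 1024] S) (auto simp: L_def)
  moreover have "dim_H \<mu> < real CARD('n)"
  proof -
    have lnB: "0 < ln (real B)" using B by simp
    have "N.sdim i \<le> 1" for i
    proof -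
      have "ln (real (L i)) \<le> ln (real B)" using L[of i] by (subst ln_le_cancel_iff) auto
      thus ?thesis using lnB unfolding N.sdim_def by (simp only: pos_divide_le_eq mult_1)
    qed
    moreover have "N.sdim i0 < 1"
    proof -
      have "real (L i0) < real B" by (simp add: L_def B_def)
      hence "ln (real (L i0)) < ln (real B)" using L[of i0] B by (subst ln_less_cancel_iff) auto
      thus ?thesis using lnB unfolding N.sdim_def by (simp only: pos_divide_less_eq mult_1)
    qed
    \<comment> \<open>One thin coordinate makes the sum strictly smaller than n.\<close>
    ultimately have "(\<Sum>i\<in>UNIV. N.sdim i) < (\<Sum>i\<in>(UNIV :: 'n set). 1)"
      by (intro sum_strict_mono_ex1) auto
    thus ?thesis using dim_H_eqI[OF M.prob_space_axioms has_dim_H_\<mu>] by simp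
  qed
  ultimately show ?thesis
    using self_similar_measure_\<mu>[OF L(3)] measure_unit_cube has_dim_H_\<mu>
    unfolding exact_dimensional_def by blast
qed

end
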